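(* Let $\sigma:\mathbb{T}\times\mathbb{Z}\to\mathbb{C}$ be a measurable function such that $\sigma(\cdot,k)\in L^2(\mathbb{T})$ for each $k\in\mathbb{Z}$, and let $T_\sigma$ be its associated pseudo-differential operator. If $\sigma$ satisfies the following three properties: (i) $\int_{\mathbb{T}}\sigma(x,k)\,dx\neq 0$ for all $k\in\mathbb{Z}$, and $\inf_{k\in\mathbb{Z}}\big|\int_{\mathbb{T}}\sigma(x,k)\,dx\big|>0$; (ii) $\displaystyle\sup_{k\in\mathbb{Z}}\Big|\int_{\mathbb{T}}\sigma(x,k)\,dx\Big|^{-1}\cdot\sum_{j\neq k}|\widehat\sigma(j-k,k)|<1$; (iii) $\displaystyle\sup_{j\in\mathbb{Z}}\Big|\int_{\mathbb{T}}\sigma(x,j)\,dx\Big|^{-1}\cdot\sum_{k\neq j}|\widehat\sigma(j-k,k)|<1$; or, equivalently, (i') $\int_{\mathbb{T}}\sigma(x,k)\,dx\neq 0$ for all $k\in\mathbb{Z}$, and $\inf_{k\in\mathbb{Z}}\big|\int_{\mathbb{T}}\sigma(x,k)\,dx\big|>0$; (ii') $\displaystyle\sup_{k\in\mathbb{Z}}\Big|\int_{\mathbb{T}}\sigma(x,k)\,dx\Big|^{-1}\cdot\|\widehat\sigma(\cdot,k)\|_{L^1(\mathbb{Z})}<2$; (iii') $\displaystyle\sup_{j\in\mathbb{Z}}\Big|\int_{\mathbb{T}}\sigma(x,j)\,dx\Big|^{-1}\cdot\|\widehat{\sigma^*}(\cdot,j)\|_{L^1(\mathbb{Z})}<2$,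 where $\sigma^*(x,k)$ is the symbol of the adjoint operator, then $T_\sigma$ is an invertible linear operator with bounded inverse. In particular, if $\lim_{|k|\to\infty}\big|\int_{\mathbb{T}}\sigma(x,k)\,dx\big|=\infty$, the inverse is a compact operator.
   Context: $\mathbb{T}=\mathbb{R}/2\pi\mathbb{Z}$ with normalized Haar measure $dx$; $\widehat f(k)=\int_{\mathbb{T}}f(x)e^{-ixk}\,dx$ for $k\in\mathbb{Z}$; $\widehat\sigma(m,k)=\int_{\mathbb{T}}\sigma(x,k)e^{-ixm}\,dx$ is the Fourier coefficient of $\sigma$ in the variable $x$; $L^p(\mathbb{Z})$ denotes the space of $p$-summable functions on $\mathbb{Z}$, i.e. $\ell^p(\mathbb{Z})$. In each supremum in (ii), (iii), (ii'), (iii') the supremum is taken of the whole product. The setting is the Hilbert space $L^2(\mathbb{T})$. The pseudo-differential operator associated to $\sigma$ is given by $(T_\sigma f)(x)=\sum_{k\in\mathbb{Z}}\sigma(x,k)\widehat f(k)e^{ixk}$, defined initially as a map from the trigonometric polynomials $\mathcal{P}(\mathbb{T})=\mathrm{Span}\{e^{ixk}:k\in\mathbb{Z}\}$ to $L^2(\mathbb{T})$. Its associated infinite matrix is $M_\sigma$ with entries $(M_\sigma)_{jk}=\widehat\sigma(j-k,k)$, $j,k\in\mathbb{Z}$, acting on functions $\varphi:\mathbb{Z}\to\mathbb{C}$ by $(M_\sigma\varphi)(j)=\sum_{k\in\mathbb{Z}}(M_\sigma)_{jk}\varphi(k)$; $T_\sigma$ is studied through the factorization $T_\sigma=\mathcal{F}_{\mathbb{T}}^{-1}M_\sigma\mathcal{F}_{\mathbb{T}}$,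 where $\mathcal{F}_{\mathbb{T}}:L^2(\mathbb{T})\to L^2(\mathbb{Z})$, $f\mapsto\widehat f$, is the (unitary) Fourier transform. The adjoint of an infinite matrix $M$ is the matrix $M^*$ with entries $(M^* )_{jk}=\overline{M_{kj}}$, and the symbol $\sigma^*$ of the adjoint operator is the one whose associated matrix is $M_\sigma^*$, i.e. $\widehat{\sigma^*}(k-j,j)=\overline{\widehat\sigma(j-k,k)}$. *)

theory Defs
  imports "HOL-Analysis.Analysis"
begin

section \<open>The torus\<close>

quotient_type torus = real / "\<lambda>x y. \<exists>n::int. x - y = 2 * pi * of_int n"
proof (rule equivpI)
  show "reflp (\<lambda>x y. \<exists>n::int. x - y = 2 * pi * of_int n)"
    by (auto intro!: reflpI exI[of _ 0])
  show "symp (\<lambda>x y. \<exists>n::int. x - y = 2 * pi * of_int n)"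
  proof (rule sympI)
    fix x y :: real
    assume "\<exists>n::int. x - y = 2 * pi * of_int n"
    then obtain n :: int where "x - y = 2 * pi * of_int n" by blast
    then have "y - x = 2 * pi * of_int (- n)" by simp
    then show "\<exists>n::int. y - x = 2 * pi * of_int n" by blast
  qed
  show "transp (\<lambda>x y. \<exists>n::int. x - y = 2 * pi * of_int n)"
  proof (rule transpI)
    fix x y z :: real
    assume "\<exists>n::int. x - y = 2 * pi * of_int n" "\<exists>n::int. y - z = 2 * pi * of_int n"
    then obtain m n :: int where "x - y = 2 * pi * of_int m" "y - z = 2 * pi * of_int n"
      by blast
    then have "x - z = 2 * pi * of_int (m + n)" by (simp add: algebra_simps)
    then show "\<exists>n::int. x - z = 2 * pi * of_int n" by blast
  qed
qed

instantiation torus :: topological_space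
begin

definition open_torus :: "torus set \<Rightarrow> bool" where
  "open_torus U \<longleftrightarrow> open (abs_torus -` U)"

instance
proof
  show "open (UNIV :: torus set)" by (simp add: open_torus_def)
  show "open (S \<inter> T)" if "open S" "open T" for S T :: "torus set"
    using that by (simp add: open_torus_def vimage_Int open_Int)
  show "open (\<Union>K)" if "\<forall>S\<in>K. open S" for K :: "torus set set"
    using that by (auto simp: open_torus_def vimage_Union intro!: open_UN)
qed

end

text \<open>Normalized Haar measure on the Borel sets, obtained from the fundamental domain
  \<open>[0, 2\<pi>)\<close>.\<close>

definition haar :: "torus measure" where
  "haar = distr (uniform_measure lborel {0..<2 * pi}) borel abs_torus"

lift_definition character :: "int \<Rightarrow> torus \<Rightarrow> complex"
  is "\<lambda>k x. cis (of_int k * x)"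
proof -
  fix k :: int and x y :: real
  assume "\<exists>n::int. x - y = 2 * pi * of_int n"
  then obtain n :: int where "x - y = 2 * pi * of_int n" by blast
  then have "of_int k * x = of_int k * y + 2 * pi * of_int (k * n)"
    by (simp add: algebra_simps)
  then show "cis (of_int k * x) = cis (of_int k * y)"
    by (simp add: cis_mult[symmetric] cis_multiple_2pi)
qed

lemma abs_torus_measurable [measurable]: "abs_torus \<in> borel_measurable borel"
proof (rule borel_measurable_continuous_onI)
  show "continuous_on UNIV abs_torus"
    by (auto simp: continuous_on_open_vimage open_torus_def)
qed

lemma space_haar [simp]: "space haar = UNIV"
  by (simp add: haar_def)

lemma sets_haar [simp, measurable_cong]: "sets haar = sets borel"
  by (simp add: haar_def)

lemma emeasure_haar_UNIV [simp]: "emeasure haar UNIV = 1"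
proof -
  have "abs_torus \<in> measurable (uniform_measure lborel {0..<2 * pi}) borel"
    by simp
  then have "emeasure haar UNIV = emeasure (uniform_measure lborel {0..<2 * pi}) UNIV"
    by (simp add: haar_def emeasure_distr)
  also have "\<dots> = 1"
    by (simp add: emeasure_uniform_measure divide_ennreal)
  finally show ?thesis .
qed

lemma finite_measure_haar: "finite_measure haar"
  by (rule finite_measureI) simp

lemma character_measurable [measurable]: "character k \<in> borel_measurable borel"
proof (rule borel_measurable_continuous_onI)
  have "open (abs_torus -` (character k -` B))" if "open B" for B
  proof -
    have "abs_torus -` (character k -` B) = (\<lambda>x. cis (of_int k * x)) -` B"
      by (auto simp: character.abs_eq)
    moreover have "continuous_on UNIV (\<lambda>x. cis (of_int k * x))"
      by (intro continuous_intros)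
    ultimately show ?thesis
      using that by (simp add: open_vimage)
  qed
  then show "continuous_on UNIV (character k)"
    by (auto simp: continuous_on_open_vimage open_torus_def)
qed

lemma norm_character [simp]: "norm (character k x) = 1"
  by transfer simp

definition fourier_coeff :: "(torus \<Rightarrow> complex) \<Rightarrow> int \<Rightarrow> complex" where
  "fourier_coeff f k = (LINT x|haar. f x * character (- k) x)"


section \<open>The Hilbert space of square-integrable functions on the torus\<close>

definition square_integrable :: "(torus \<Rightarrow> complex) \<Rightarrow> bool" where
  "square_integrable f \<longleftrightarrow>
     f \<in> borel_measurable haar \<and> integrable haar (\<lambda>x. (cmod (f x))\<^sup>2)"

lemma square_integrable_measurable [measurable_dest]:
  "square_integrable f \<Longrightarrow> f \<in> borel_measurable haar"
  by (simp add: square_integrable_def)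

lemma square_integrable_0: "square_integrable (\<lambda>_. 0)"
  by (simp add: square_integrable_def)

lemma square_integrable_add:
  assumes f: "square_integrable f" and g: "square_integrable g"
  shows "square_integrable (\<lambda>x. f x + g x)"
proof -
  note [measurable] = square_integrable_measurable[OF f] square_integrable_measurable[OF g]
  have "integrable haar (\<lambda>x. 2 * (cmod (f x))\<^sup>2 + 2 * (cmod (g x))\<^sup>2)"
    using f g by (simp add: square_integrable_def)
  then have "integrable haar (\<lambda>x. (cmod (f x + g x))\<^sup>2)"
  proof (rule Bochner_Integration.integrable_bound)
    show "AE x in haar. norm ((cmod (f x + g x))\<^sup>2)
            \<le> norm (2 * (cmod (f x))\<^sup>2 + 2 * (cmod (g x))\<^sup>2)"
    proof (rule AE_I2)
      fix x
      have "(cmod (f x + g x))\<^sup>2 \<le> (cmod (f x) + cmod (g x))\<^sup>2"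
        by (intro power_mono norm_triangle_ineq) simp
      also have "\<dots> \<le> 2 * (cmod (f x))\<^sup>2 + 2 * (cmod (g x))\<^sup>2"
        using sum_squares_bound[of "cmod (f x)" "cmod (g x)"]
        by (simp add: power2_sum)
      finally show "norm ((cmod (f x + g x))\<^sup>2)
            \<le> norm (2 * (cmod (f x))\<^sup>2 + 2 * (cmod (g x))\<^sup>2)" by simp
    qed
  qed simp
  then show ?thesis
    by (simp add: square_integrable_def)
qed

lemma square_integrable_cmult:
  assumes f: "square_integrable f"
  shows "square_integrable (\<lambda>x. c * f x)"
  using assms by (auto simp: square_integrable_def norm_mult power_mult_distrib)

lemma borel_measurable_cnj [measurable (raw)]:
  "f \<in> borel_measurable M \<Longrightarrow> (\<lambda>x. cnj (f x)) \<in> borel_measurable M"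
  by (rule measurable_compose[OF _ borel_measurable_continuous_onI])
    (auto intro: continuous_intros)

lemma square_integrable_mult_cnj:
  assumes f: "square_integrable f" and g: "square_integrable g"
  shows "integrable haar (\<lambda>x. f x * cnj (g x))"
proof -
  note [measurable] = square_integrable_measurable[OF f] square_integrable_measurable[OF g]
  have "integrable haar (\<lambda>x. (cmod (f x))\<^sup>2 + (cmod (g x))\<^sup>2)"
    using f g by (simp add: square_integrable_def)
  then show ?thesis
  proof (rule Bochner_Integration.integrable_bound)
    show "AE x in haar. norm (f x * cnj (g x)) \<le> norm ((cmod (f x))\<^sup>2 + (cmod (g x))\<^sup>2)"
    proof (rule AE_I2)
      fix x
      have "0 \<le> cmod (f x) * cmod (g x)" by simp
      then have "cmod (f x) * cmod (g x) \<le> (cmod (f x))\<^sup>2 + (cmod (g x))\<^sup>2"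
        using sum_squares_bound[of "cmod (f x)" "cmod (g x)"] by linarith
      then show "norm (f x * cnj (g x)) \<le> norm ((cmod (f x))\<^sup>2 + (cmod (g x))\<^sup>2)"
        by (simp add: norm_mult)
    qed
  qed simp
qed

lemma square_integrable_character: "square_integrable (character k)"
proof -
  interpret finite_measure haar by (rule finite_measure_haar)
  show ?thesis by (simp add: square_integrable_def)
qed

quotient_type l2_torus = "torus \<Rightarrow> complex" / partial:
  "\<lambda>f g. square_integrable f \<and> square_integrable g \<and> (AE x in haar. f x = g x)"
proof (rule part_equivpI)
  show "\<exists>f. square_integrable f \<and> square_integrable f \<and> (AE x in haar. f x = f x)"
    using square_integrable_0 by auto
qed (auto intro!: sympI transpI)

instantiation l2_torus :: real_inner
begin

lift_definition zero_l2_torus :: l2_torus is "\<lambda>_. 0"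
  by (simp add: square_integrable_0)

lift_definition plus_l2_torus :: "l2_torus \<Rightarrow> l2_torus \<Rightarrow> l2_torus" is "\<lambda>f g x. f x + g x"
  by (auto intro: square_integrable_add)

lift_definition uminus_l2_torus :: "l2_torus \<Rightarrow> l2_torus" is "\<lambda>f x. - f x"
  by (auto dest: square_integrable_cmult[where c = "-1"])

definition minus_l2_torus :: "l2_torus \<Rightarrow> l2_torus \<Rightarrow> l2_torus" where
  "minus_l2_torus f g = f + - g"

lift_definition scaleR_l2_torus :: "real \<Rightarrow> l2_torus \<Rightarrow> l2_torus"
  is "\<lambda>r f x. complex_of_real r * f x"
  by (auto intro: square_integrable_cmult)

text \<open>The real part of the complex inner product; it induces the usual norm.\<close>

lift_definition inner_l2_torus :: "l2_torus \<Rightarrow> l2_torus \<Rightarrow> real"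
  is "\<lambda>f g. Re (LINT x|haar. f x * cnj (g x))"
proof -
  fix f f' g g'
  assume a: "square_integrable f \<and> square_integrable f' \<and> (AE x in haar. f x = f' x)"
    "square_integrable g \<and> square_integrable g' \<and> (AE x in haar. g x = g' x)"
  then have [measurable]: "f \<in> borel_measurable haar" "f' \<in> borel_measurable haar"
    "g \<in> borel_measurable haar" "g' \<in> borel_measurable haar"
    by (auto simp: square_integrable_measurable)
  have "(LINT x|haar. f x * cnj (g x)) = (LINT x|haar. f' x * cnj (g' x))"
    using a by (intro integral_cong_AE) auto
  then show "Re (LINT x|haar. f x * cnj (g x)) = Re (LINT x|haar. f' x * cnj (g' x))"
    by simp
qed

definition norm_l2_torus :: "l2_torus \<Rightarrow> real" where
  "norm_l2_torus f = sqrt (inner f f)"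

definition dist_l2_torus :: "l2_torus \<Rightarrow> l2_torus \<Rightarrow> real" where
  "dist_l2_torus f g = norm (f - g)"

definition sgn_l2_torus :: "l2_torus \<Rightarrow> l2_torus" where
  "sgn_l2_torus f = inverse (norm f) *\<^sub>R f"

definition uniformity_l2_torus :: "(l2_torus \<times> l2_torus) filter" where
  "uniformity_l2_torus = (INF e\<in>{0<..}. principal {(x, y). dist x y < e})"

definition open_l2_torus :: "l2_torus set \<Rightarrow> bool" where
  "open_l2_torus U \<longleftrightarrow> (\<forall>x\<in>U. eventually (\<lambda>(x', y). x' = x \<longrightarrow> y \<in> U) uniformity)"

instance
proof
  fix f g h :: l2_torus and r s :: real
  show "f + g + h = f + (g + h)"
    by transfer (auto intro!: square_integrable_add simp: add.assoc)
  show "f + g = g + f"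
    by transfer (auto intro!: square_integrable_add simp: add.commute)
  show "0 + f = f"
    by transfer (auto intro!: square_integrable_add)
  show "- f + f = 0"
    by transfer (auto simp: square_integrable_0)
  show "f - g = f + - g"
    by (simp add: minus_l2_torus_def)
  show "r *\<^sub>R (f + g) = r *\<^sub>R f + r *\<^sub>R g"
    by transfer (auto intro!: square_integrable_add square_integrable_cmult simp: distrib_left)
  show "(r + s) *\<^sub>R f = r *\<^sub>R f + s *\<^sub>R f"
    by transfer (auto intro!: square_integrable_add square_integrable_cmult
        simp: distrib_right)
  show "r *\<^sub>R s *\<^sub>R f = (r * s) *\<^sub>R f"
    by transfer (auto intro!: square_integrable_cmult simp: mult.assoc)
  show "1 *\<^sub>R f = f"
    by transfer auto
  show "inner f g = inner g f"
  proof transfer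
    fix f g :: "torus \<Rightarrow> complex"
    have "(LINT x|haar. f x * cnj (g x)) = cnj (LINT x|haar. g x * cnj (f x))"
      by (simp add: mult.commute flip: Bochner_Integration.integral_cnj)
    then show "Re (LINT x|haar. f x * cnj (g x)) = Re (LINT x|haar. g x * cnj (f x))"
      by simp
  qed
  show "inner (f + g) h = inner f h + inner g h"
    by transfer (auto simp: distrib_right square_integrable_mult_cnj)
  show "inner (r *\<^sub>R f) g = r * inner f g"
    by transfer (auto simp: mult.assoc)
  have sq: "Re (LINT x|haar. f x * cnj (f x)) = (LINT x|haar. (cmod (f x))\<^sup>2)"
    for f :: "torus \<Rightarrow> complex"
    by (simp flip: complex_norm_square del: of_real_power)
  show "0 \<le> inner f f"
    by transfer (simp add: sq)
  show "(inner f f = 0) = (f = 0)"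
  proof transfer
    fix f :: "torus \<Rightarrow> complex"
    assume "square_integrable f \<and> square_integrable f \<and> (AE x in haar. f x = f x)"
    then have f: "square_integrable f" by simp
    then have "((LINT x|haar. (cmod (f x))\<^sup>2) = 0) = (AE x in haar. (cmod (f x))\<^sup>2 = 0)"
      by (intro integral_nonneg_eq_0_iff_AE) (auto simp: square_integrable_def)
    then show "(Re (LINT x|haar. f x * cnj (f x)) = 0)
        = (square_integrable f \<and> square_integrable (\<lambda>_. 0) \<and> (AE x in haar. f x = 0))"
      using f by (simp add: sq square_integrable_0)
  qed
  show "norm f = sqrt (inner f f)"
    by (simp add: norm_l2_torus_def)
  show "dist f g = norm (f - g)"
    by (simp add: dist_l2_torus_def)
  show "sgn f = inverse (norm f) *\<^sub>R f"
    by (simp add: sgn_l2_torus_def)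
  show "(uniformity :: (l2_torus \<times> l2_torus) filter)
      = (INF e\<in>{0<..}. principal {(x, y). dist x y < e})"
    by (simp add: uniformity_l2_torus_def)
  show "open U \<longleftrightarrow> (\<forall>x\<in>U. \<forall>\<^sub>F (x', y) in uniformity. x' = x \<longrightarrow> y \<in> U)"
    for U :: "l2_torus set"
    by (simp add: open_l2_torus_def)
qed

end

lift_definition scaleC :: "complex \<Rightarrow> l2_torus \<Rightarrow> l2_torus" (infixr \<open>*\<^sub>C\<close> 75)
  is "\<lambda>c f x. c * f x"
  by (auto intro: square_integrable_cmult)

global_interpretation complex_l2: vector_space scaleC
  defines cspan = complex_l2.span
proof
  fix c d :: complex and f g :: l2_torus
  show "c *\<^sub>C (f + g) = c *\<^sub>C f + c *\<^sub>C g"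
    by transfer (auto intro!: square_integrable_add square_integrable_cmult simp: distrib_left)
  show "(c + d) *\<^sub>C f = c *\<^sub>C f + d *\<^sub>C f"
    by transfer (auto intro!: square_integrable_add square_integrable_cmult simp: distrib_right)
  show "c *\<^sub>C d *\<^sub>C f = (c * d) *\<^sub>C f"
    by transfer (auto intro!: square_integrable_cmult simp: mult.assoc)
  show "1 *\<^sub>C f = f"
    by transfer auto
qed

lift_definition fourier :: "l2_torus \<Rightarrow> int \<Rightarrow> complex" is fourier_coeff
  unfolding fourier_coeff_def
  by (intro ext integral_cong_AE) (auto simp: square_integrable_measurable)

lift_definition exponential :: "int \<Rightarrow> l2_torus" is character
  by (simp add: square_integrable_character)

definition trig_polys :: "l2_torus set" where
  "trig_polys = cspan (range exponential)"


section \<open>Operators in the Hilbert space\<close>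

text \<open>Possibly unbounded and not everywhere defined operators are represented by their graphs.\<close>

definition linear_operator :: "(l2_torus \<times> l2_torus) set \<Rightarrow> bool" where
  "linear_operator G \<longleftrightarrow>
     single_valued G \<and> (0, 0) \<in> G \<and>
     (\<forall>f g f' g'. (f, g) \<in> G \<longrightarrow> (f', g') \<in> G \<longrightarrow> (f + f', g + g') \<in> G) \<and>
     (\<forall>c f g. (f, g) \<in> G \<longrightarrow> (c *\<^sub>C f, c *\<^sub>C g) \<in> G)"

definition bounded_operator :: "(l2_torus \<Rightarrow> l2_torus) \<Rightarrow> bool" where
  "bounded_operator S \<longleftrightarrow> bounded_linear S \<and> (\<forall>c f. S (c *\<^sub>C f) = c *\<^sub>C S f)"

text \<open>\<open>S\<close> is defined everywhere, so this says that the operator with graph \<open>G\<close> maps its domain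
  bijectively onto the whole space, with inverse \<open>S\<close>.\<close>

definition inverse_operator :: "(l2_torus \<times> l2_torus) set \<Rightarrow> (l2_torus \<Rightarrow> l2_torus) \<Rightarrow> bool" where
  "inverse_operator G S \<longleftrightarrow> single_valued G \<and> (\<forall>f g. (f, g) \<in> G \<longleftrightarrow> S g = f)"

definition compact_operator :: "(l2_torus \<Rightarrow> l2_torus) \<Rightarrow> bool" where
  "compact_operator S \<longleftrightarrow>
     bounded_operator S \<and> (\<forall>B. bounded B \<longrightarrow> compact (closure (S ` B)))"


section \<open>Pseudo-differential operators\<close>

definition l2_symbol :: "(torus \<Rightarrow> int \<Rightarrow> complex) \<Rightarrow> bool" where
  "l2_symbol \<sigma> \<longleftrightarrow>
     (\<lambda>(x, k). \<sigma> x k) \<in> borel_measurable (haar \<Otimes>\<^sub>M count_space UNIV) \<and>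
     (\<forall>k. square_integrable (\<lambda>x. \<sigma> x k))"

definition symbol_hat :: "(torus \<Rightarrow> int \<Rightarrow> complex) \<Rightarrow> int \<Rightarrow> int \<Rightarrow> complex" where
  "symbol_hat \<sigma> m k = fourier_coeff (\<lambda>x. \<sigma> x k) m"

definition symbol_matrix :: "(torus \<Rightarrow> int \<Rightarrow> complex) \<Rightarrow> int \<Rightarrow> int \<Rightarrow> complex" where
  "symbol_matrix \<sigma> j k = symbol_hat \<sigma> (j - k) k"

text \<open>Used only on trigonometric polynomials, where the series is a finite sum. The operator on
  the Hilbert space is obtained from its values there by closing the graph.\<close>

definition pseudo_diff :: "(torus \<Rightarrow> int \<Rightarrow> complex) \<Rightarrow> l2_torus \<Rightarrow> l2_torus" where
  "pseudo_diff \<sigma> f = abs_l2_torus (\<lambda>x. \<Sum>\<^sub>\<infinity>k. \<sigma> x k * fourier f k * character k x)"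

definition minimal_graph :: "(torus \<Rightarrow> int \<Rightarrow> complex) \<Rightarrow> (l2_torus \<times> l2_torus) set" where
  "minimal_graph \<sigma> = {(f, pseudo_diff \<sigma> f) | f. f \<in> trig_polys}"

text \<open>The operator \<open>\<F>\<inverse> M \<F>\<close> on its natural domain: those \<open>f\<close> for which \<open>M \<F> f\<close> is defined and
  is the sequence of Fourier coefficients of a square-integrable function \<open>g\<close>.\<close>

definition maximal_graph :: "(torus \<Rightarrow> int \<Rightarrow> complex) \<Rightarrow> (l2_torus \<times> l2_torus) set" where
  "maximal_graph \<sigma> =
     {(f, g). \<forall>j. ((\<lambda>k. symbol_matrix \<sigma> j k * fourier f k) has_sum fourier g j) UNIV}"

definition adjoint_symbol ::
  "(torus \<Rightarrow> int \<Rightarrow> complex) \<Rightarrow> (torus \<Rightarrow> int \<Rightarrow> complex) \<Rightarrow> bool" where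
  "adjoint_symbol \<sigma> \<sigma>' \<longleftrightarrow>
     l2_symbol \<sigma>' \<and> (\<forall>j k. symbol_matrix \<sigma>' j k = cnj (symbol_matrix \<sigma> k j))"

definition abs_mean :: "(torus \<Rightarrow> int \<Rightarrow> complex) \<Rightarrow> int \<Rightarrow> real" where
  "abs_mean \<sigma> k = cmod (LINT x|haar. \<sigma> x k)"

definition mean_bounded_below :: "(torus \<Rightarrow> int \<Rightarrow> complex) \<Rightarrow> bool" where
  "mean_bounded_below \<sigma> \<longleftrightarrow>
     (\<forall>k. (LINT x|haar. \<sigma> x k) \<noteq> 0) \<and> 0 < (INF k. abs_mean \<sigma> k)"

text \<open>The suprema and the sums of absolute values are taken in \<^typ>\<open>ennreal\<close>, where they always
  exist, so that an upper bound on them includes their finiteness.\<close>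

definition diagonally_dominant :: "(torus \<Rightarrow> int \<Rightarrow> complex) \<Rightarrow> bool" where
  "diagonally_dominant \<sigma> \<longleftrightarrow>
     mean_bounded_below \<sigma> \<and>
     (SUP k. inverse (ennreal (abs_mean \<sigma> k)) *
        (\<Sum>\<^sub>\<infinity>j\<in>- {k}. ennreal (cmod (symbol_hat \<sigma> (j - k) k)))) < 1 \<and>
     (SUP j. inverse (ennreal (abs_mean \<sigma> j)) *
        (\<Sum>\<^sub>\<infinity>k\<in>- {j}. ennreal (cmod (symbol_hat \<sigma> (j - k) k)))) < 1"

definition l1_norm :: "(int \<Rightarrow> complex) \<Rightarrow> ennreal" where
  "l1_norm \<phi> = (\<Sum>\<^sub>\<infinity>m. ennreal (cmod (\<phi> m)))"

definition diagonally_dominant_l1 :: "(torus \<Rightarrow> int \<Rightarrow> complex) \<Rightarrow> bool" where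
  "diagonally_dominant_l1 \<sigma> \<longleftrightarrow>
     mean_bounded_below \<sigma> \<and>
     (SUP k. inverse (ennreal (abs_mean \<sigma> k)) * l1_norm (\<lambda>m. symbol_hat \<sigma> m k)) < 2 \<and>
     (\<exists>\<sigma>'. adjoint_symbol \<sigma> \<sigma>' \<and>
        (SUP j. inverse (ennreal (abs_mean \<sigma> j)) * l1_norm (\<lambda>m. symbol_hat \<sigma>' m j)) < 2)"

end

theory Submission
  imports Defs
begin

text \<open>
  On Fourier coefficients the operator is the infinite matrix \<open>M\<close> of the symbol, whose diagonal
  consists of the means of \<open>\<sigma>(\<cdot>, k)\<close>. Three estimates, each a direct use of diagonal dominance with
  ratio \<open>q < 1\<close>, carry the proof.

  \<^item> Coercivity (\<open>energy\<close>): if \<open>g\<close> is the image of \<open>f\<close>, then pairing \<open>g\<close> with \<open>f\<close>, rotated by the phases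
    of the diagonal, gives
    \<open>(1 - q) * (\<Sum>j. \<bar>M j j\<bar> * \<bar>fourier f j\<bar>\<^sup>2) \<le> norm f * norm g\<close>. Rows and columns each absorb half of
    the off-diagonal terms, by the inequality of arithmetic and geometric means. As the diagonal is
    bounded away from zero, the norm of \<open>f\<close> is bounded by a constant times that of \<open>g\<close>.
  \<^item> Injectivity of the maximal operator (\<open>maximal_injective\<close>): row dominance makes the supremum \<open>s\<close>
    of the coefficients of an element of the kernel satisfy \<open>s \<le> q * s\<close>.
  \<^item> Density of the range of the minimal operator (\<open>trig_range_dense\<close>): column dominance makes the
    supremum \<open>s\<close> of the distances of the exponentials from the range satisfy \<open>s \<le> q * s\<close>.

  By completeness, coercivity and density make the closure of the minimal operator surjective. The
  maximal operator is a closed injective extension of it, so the two coincide, and the common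
  inverse is bounded by coercivity. If the diagonal tends to infinity, the weights in the coercivity
  estimate make the tails of the Fourier series of solutions uniformly small, so the inverse maps
  bounded sets to totally bounded ones.

  The first sections provide the Hilbert space theory that this needs: functions are determined by
  their Fourier coefficients (\<open>fourier_null_AE_0\<close>, from the Stone-Weierstrass theorem on the unit
  circle), the space is complete, and Fourier series converge in it (\<open>fourier_partial_tendsto\<close>).
\<close>

section \<open>Characters and uniqueness of Fourier coefficients\<close>

interpretation haar: finite_measure haar
  by (rule finite_measure_haar)

lemma character_0 [simp]: "character 0 x = 1"
  by transfer simp

lemma character_add: "character (j + k) x = character j x * character k x"
  by transfer (simp add: cis_mult distrib_right)

lemma cnj_character: "cnj (character k x) = character (- k) x"
  by transfer (simp add: cis_cnj)

lemma integral_haar: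
  fixes f :: "torus \<Rightarrow> complex"
  assumes [measurable]: "f \<in> borel_measurable borel"
  shows "(LINT x|haar. f x) = (LINT t|uniform_measure lborel {0..<2 * pi}. f (abs_torus t))"
  unfolding haar_def by (rule integral_distr) simp_all

lemma integral_character: "(LINT x|haar. character k x) = (if k = 0 then 1 else 0)"
proof (cases "k = 0")
  case True
  have "measure haar UNIV = 1"
    by (simp add: measure_def)
  then show ?thesis
    using True by simp
next
  case False
  have dens: "uniform_measure lborel {0..<2 * pi}
      = density lborel (\<lambda>t. ennreal (indicator {0..<2 * pi} t / (2 * pi)))"
    unfolding uniform_measure_def
    by (intro density_cong)
      (auto simp: divide_ennreal[of 1 "2 * pi", simplified] split: split_indicator)
  define F where "F t = cis (of_int k * t) / (\<i> * of_int k)" for t :: real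
  have F: "(F has_vector_derivative cis (of_int k * t)) (at t within T)" for t T
  proof -
    have "((\<lambda>z. exp (\<i> * of_int k * z) / (\<i> * of_int k)) has_field_derivative exp (\<i> * of_int k * of_real t))
        (at (of_real t))"
      using False by (auto intro!: derivative_eq_intros)
    from has_vector_derivative_real_field[OF this] show ?thesis
      by (simp add: F_def[abs_def] cis_conv_exp mult.assoc)
  qed
  have [measurable]: "(\<lambda>t. cis (of_int k * t)) \<in> borel_measurable borel"
    by (intro borel_measurable_continuous_onI continuous_intros)
  have "(LINT x|haar. character k x)
      = (LINT t|lborel. indicator {0..<2 * pi} t *\<^sub>R (cis (of_int k * t) / (2 * pi)))"
  proof -
    have "(indicator {0..<2 * pi} t / (2 * pi)) *\<^sub>R cis (of_int k * t)
        = indicator {0..<2 * pi} t *\<^sub>R (cis (of_int k * t) / (2 * pi))" for t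
      by (simp add: scaleR_conv_of_real)
    moreover have "(LINT t|uniform_measure lborel {0..<2 * pi}. cis (of_int k * t))
        = (LINT t|lborel. (indicator {0..<2 * pi} t / (2 * pi)) *\<^sub>R cis (of_int k * t))"
      unfolding dens
      by (rule integral_density) auto
    ultimately show ?thesis
      by (simp add: integral_haar character.abs_eq)
  qed
  also have "\<dots> = (LINT t|lborel. indicator {0..2 * pi} t *\<^sub>R (cis (of_int k * t) / (2 * pi)))"
    by (intro integral_cong_AE)
      (auto intro!: AE_I[where N="{2*pi}"] split: split_indicator)
  also have "\<dots> = (LINT t|lborel. indicator {0..2 * pi} t *\<^sub>R cis (of_int k * t)) / (2 * pi)"
    by (simp add: scaleR_conv_of_real)
  also have "(LINT t|lborel. indicator {0..2 * pi} t *\<^sub>R cis (of_int k * t)) = F (2 * pi) - F 0"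
    by (intro integral_FTC_Icc F) (auto intro!: continuous_intros)
  also have "F (2 * pi) - F 0 = 0"
    using cis_multiple_2pi[of "of_int k"] by (simp add: F_def mult.commute)
  finally show ?thesis
    using False by simp
qed

lemma fourier_coeff_character: "fourier_coeff (character j) k = (if j = k then 1 else 0)"
  unfolding fourier_coeff_def by (simp add: character_add[symmetric] integral_character)

lemma integrable_mult_bounded:
  fixes f h :: "torus \<Rightarrow> complex"
  assumes f: "integrable haar f" and [measurable]: "h \<in> borel_measurable haar"
    and h: "\<And>x. cmod (h x) \<le> B"
  shows "integrable haar (\<lambda>x. f x * h x)"
proof (rule Bochner_Integration.integrable_bound)
  show "integrable haar (\<lambda>x. B * norm (f x))"
    using f by auto
  show "(\<lambda>x. f x * h x) \<in> borel_measurable haar"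
    using f by measurable
  show "AE x in haar. norm (f x * h x) \<le> norm (B * norm (f x))"
  proof (rule AE_I2)
    fix x
    have "0 \<le> B"
      using h[of x] norm_ge_zero[of "h x"] by linarith
    with mult_right_mono[OF h[of x] norm_ge_zero[of "f x"]]
    show "norm (f x * h x) \<le> norm (B * norm (f x))"
      by (simp add: norm_mult mult.commute)
  qed
qed

text \<open>The integrable functions with vanishing Fourier coefficients form a space that is closed under
  multiplication by characters. Hence it is closed under multiplication by every polynomial in the
  real and imaginary parts of \<open>character 1\<close>, and uniform approximation then lets these functions be
  tested against all continuous functions.\<close>
definition fourier_null :: "(torus \<Rightarrow> complex) \<Rightarrow> bool" where
  "fourier_null f \<longleftrightarrow> integrable haar f \<and> (\<forall>k. fourier_coeff f k = 0)"

lemma fourier_null_add: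
  assumes "fourier_null f" "fourier_null g"
  shows "fourier_null (\<lambda>x. f x + g x)"
  using assms
  by (auto simp: fourier_null_def fourier_coeff_def distrib_right integrable_mult_bounded[where B=1])

lemma fourier_null_cmult: "fourier_null f \<Longrightarrow> fourier_null (\<lambda>x. f x * c)"
  by (auto simp: fourier_null_def fourier_coeff_def mult.assoc mult.commute[of c])
    (simp flip: mult.assoc)

lemma fourier_null_character:
  assumes "fourier_null f" shows "fourier_null (\<lambda>x. f x * character m x)"
proof -
  have "fourier_coeff (\<lambda>x. f x * character m x) k = fourier_coeff f (k - m)" for k
    unfolding fourier_coeff_def using character_add[of m "- k"]
    by (simp add: mult.assoc)
  then show ?thesis
    using assms by (auto simp: fourier_null_def integrable_mult_bounded[where B=1])
qed

text \<open>Induction over the polynomial works for all \<open>f\<close> at once, so that the product of two polynomials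
  is handled by applying the two induction hypotheses one after the other.\<close>
lemma fourier_null_real_polynomial:
  assumes "real_polynomial_function p" "fourier_null f"
  shows "fourier_null (\<lambda>x. f x * of_real (p (character 1 x)))"
  using assms
proof (induction arbitrary: f)
  case (linear p)
  interpret bounded_linear p by fact
  define a where "a = complex_of_real (p 1)"
  define b where "b = complex_of_real (p \<i>)"
  \<comment> \<open>A real-linear map on the complex numbers is a combination of \<open>z\<close> and \<open>cnj z\<close>.\<close>
  define c d where "c = a / 2 + b / (2 * \<i>)" and "d = a / 2 - b / (2 * \<i>)"
  have p: "of_real (p z) = c * z + d * cnj z" for z
  proof -
    have "p z = Re z * p 1 + Im z * p \<i>"
      using add[of "Re z *\<^sub>R 1" "Im z *\<^sub>R \<i>"] complex_eq[of z] scaleR[of "Re z" 1] scaleR[of "Im z" \<i>]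
      by (simp add: scaleR_conv_of_real mult.commute)
    then show ?thesis
      by (auto simp: complex_eq_iff c_def d_def a_def b_def field_simps)
  qed
  have "f x * of_real (p (character 1 x))
      = f x * character 1 x * c + f x * character (- 1) x * d" for x
    by (simp add: p cnj_character algebra_simps)
  then show ?case
    using linear.prems
    by (simp only:) (intro fourier_null_add fourier_null_cmult fourier_null_character)
next
  case (const c)
  then show ?case by (rule fourier_null_cmult)
next
  case (add p q)
  then show ?case by (simp add: distrib_left fourier_null_add)
next
  case (mult p q)
  from mult.IH(2)[OF mult.IH(1)[OF mult.prems]] show ?case
    by (simp add: mult.assoc)
qed

lemma fourier_null_continuous:
  assumes f: "fourier_null f" and G: "continuous_on (sphere 0 1) (G :: complex \<Rightarrow> real)"
    and [measurable]: "G \<in> borel_measurable borel"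
  shows "(LINT x|haar. f x * of_real (G (character 1 x))) = 0"
proof -
  have fi: "integrable haar f"
    using f by (simp add: fourier_null_def)
  obtain B where B: "\<And>z. z \<in> sphere 0 1 \<Longrightarrow> norm (G z) \<le> B"
    using compact_imp_bounded[OF compact_continuous_image[OF G compact_sphere]]
    by (force simp: bounded_iff)
  have Gi: "integrable haar (\<lambda>x. f x * of_real (G (character 1 x)))"
    by (rule integrable_mult_bounded[OF fi, where B=B]) (use B in auto)
  have bound: "cmod (LINT x|haar. f x * of_real (G (character 1 x))) \<le> e * (LINT x|haar. norm (f x))"
    if "e > 0" for e
  proof -
    obtain p where p: "real_polynomial_function p"
      and pe: "\<And>z. z \<in> sphere 0 1 \<Longrightarrow> \<bar>G z - p z\<bar> < e"
      using Stone_Weierstrass_real_polynomial_function[OF compact_sphere G \<open>e > 0\<close>] by blast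
    have P: "fourier_null (\<lambda>x. f x * of_real (p (character 1 x)))"
      by (rule fourier_null_real_polynomial[OF p f])
    then have Pi: "integrable haar (\<lambda>x. f x * of_real (p (character 1 x)))"
      and "(LINT x|haar. f x * of_real (p (character 1 x))) = 0"
      by (auto simp: fourier_null_def fourier_coeff_def dest!: spec[of _ 0])
    then have "(LINT x|haar. f x * of_real (G (character 1 x)))
        = (LINT x|haar. f x * of_real (G (character 1 x)) - f x * of_real (p (character 1 x)))"
      using Gi by simp
    also have "cmod \<dots> \<le> (LINT x|haar. e * norm (f x))"
    proof (rule order_trans[OF integral_norm_bound integral_mono])
      show "norm (f x * of_real (G (character 1 x)) - f x * of_real (p (character 1 x)))
          \<le> e * norm (f x)" for x
        using mult_right_mono[OF less_imp_le[OF pe[of "character 1 x"]] norm_ge_zero[of "f x"]]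
        by (simp add: norm_mult mult.commute flip: of_real_diff right_diff_distrib)
    qed (use Gi Pi fi in auto)
    finally show ?thesis by simp
  qed
  then have "cmod (LINT x|haar. f x * of_real (G (character 1 x))) \<le> 0 + e"
    if "e > 0" for e
  proof -
    \<comment> \<open>The denominator is \<open>I + 1\<close> because \<open>I\<close> may vanish.\<close>
    define I where "I = (LINT x|haar. norm (f x))"
    have I: "0 \<le> I" by (simp add: I_def)
    then have "e / (I + 1) * I \<le> e"
      using that by (simp add: field_simps)
    then show ?thesis
      using bound[of "e / (I + 1)"] that I unfolding I_def[symmetric] by simp
  qed
  then show ?thesis
    using field_le_epsilon by (metis norm_le_zero_iff)
qed

lemma inj_character_1: "inj (character 1)"
proof (rule injI)
  fix x y assume "character 1 x = character 1 y"
  then show "x = y"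
  proof transfer
    fix s t :: real assume "cis (of_int 1 * s) = cis (of_int 1 * t)"
    then have "cis (s - t) = 1"
      by (simp add: cis_divide[symmetric])
    then show "\<exists>n::int. s - t = 2 * pi * of_int n"
      by (auto simp: complex_eq_iff cos_one_2pi_int)
  qed
qed

text \<open>The topology of the torus is a quotient topology, without a metric. This lemma makes \<open>character 1\<close> a homeomorphism onto the unit
  circle, where distances to closed sets are available.\<close>
lemma compact_character_image:
  assumes "closed K" shows "compact (character 1 ` K)"
proof -
  define L where "L = {0..2 * pi} \<inter> abs_torus -` K"
  have "closed (abs_torus -` K)"
    using assms by (simp add: closed_def open_torus_def vimage_Compl)
  then have "compact ((\<lambda>t. cis t) ` L)"
    unfolding L_def by (intro compact_continuous_image continuous_intros) (auto intro: compact_Int_closed)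
  also have "cis ` L = character 1 ` K"
  proof safe
    fix t assume "t \<in> L"
    then show "cis t \<in> character 1 ` K"
      by (auto simp: L_def character.abs_eq intro!: image_eqI[of _ _ "abs_torus t"])
  next
    fix x assume "x \<in> K"
    obtain s where s: "x = abs_torus s"
      using Quotient3_abs_rep[OF Quotient3_torus] by metis
    define t where "t = s - 2 * pi * of_int \<lfloor>s / (2 * pi)\<rfloor>"
    have "x = abs_torus t"
      unfolding s t_def torus.abs_eq_iff by (intro exI[of _ "\<lfloor>s / (2 * pi)\<rfloor>"]) simp
    moreover have "t \<in> {0..2 * pi}"
    proof -
      have "of_int \<lfloor>s / (2 * pi)\<rfloor> * (2 * pi) \<le> s"
        "s < (of_int \<lfloor>s / (2 * pi)\<rfloor> + 1) * (2 * pi)"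
        by (simp_all add: floor_divide_lower floor_divide_upper)
      then show ?thesis
        by (simp add: t_def distrib_right distrib_left mult.commute)
    qed
    ultimately show "character 1 x \<in> cis ` L"
      using \<open>x \<in> K\<close> by (auto simp: L_def character.abs_eq intro!: image_eqI[of _ _ t])
  qed
  finally show ?thesis .
qed

lemma fourier_null_open:
  assumes f: "fourier_null f" and U: "open U"
  shows "(LINT x|haar. f x * indicator U x) = 0"
proof (cases "U = UNIV")
  case True
  then show ?thesis
    using f by (auto simp: fourier_null_def fourier_coeff_def dest!: spec[of _ 0])
next
  case False
  \<comment> \<open>The functions \<open>G n\<close> are continuous and increase to the indicator of the complement of \<open>C\<close>.
    The case \<open>U = UNIV\<close> is separate because \<open>infdist z {} = 0\<close>.\<close>
  define C where "C = character 1 ` (- U)"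
  define G where "G n z = min 1 (real n * infdist z C)" for n z
  have C: "closed C" "C \<noteq> {}"
    using False U compact_imp_closed[OF compact_character_image[of "- U"]]
    by (auto simp: C_def closed_Compl)
  have cont: "continuous_on A (G n)" for A n
    unfolding G_def by (intro continuous_intros)
  have [measurable]: "G n \<in> borel_measurable borel" for n
    by (rule borel_measurable_continuous_onI[OF cont])
  have fi: "integrable haar f" and [measurable]: "f \<in> borel_measurable haar"
    using f by (auto simp: fourier_null_def)
  have [measurable]: "U \<in> sets haar"
    using U by simp
  have lim: "(\<lambda>n. G n (character 1 x)) \<longlonglongrightarrow> indicator U x" for x
  proof (cases "x \<in> U")
    case True
    then have "character 1 x \<notin> C"
      using inj_character_1 by (auto simp: C_def inj_def)
    then have pos: "infdist (character 1 x) C > 0"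
      using C by (metis in_closed_iff_infdist_zero infdist_nonneg less_eq_real_def)
    obtain N where "1 / infdist (character 1 x) C \<le> real N"
      using real_arch_simple by blast
    then have "G n (character 1 x) = 1" if "n \<ge> N" for n
    proof -
      have "1 \<le> real N * infdist (character 1 x) C"
        using \<open>1 / _ \<le> real N\<close> pos by (simp add: field_simps)
      also have "\<dots> \<le> real n * infdist (character 1 x) C"
        using that pos by simp
      finally show ?thesis by (simp add: G_def)
    qed
    then show ?thesis
      using True by (intro tendsto_eventually) (auto simp: eventually_sequentially)
  next
    case False
    then have "infdist (character 1 x) C = 0"
      by (simp add: C_def)
    then show ?thesis
      using False by (simp add: G_def)
  qed
  have "(\<lambda>n. LINT x|haar. f x * of_real (G n (character 1 x)))
      \<longlonglongrightarrow> (LINT x|haar. f x * indicator U x)"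
  proof (rule integral_dominated_convergence[where w="\<lambda>x. norm (f x)"])
    show "AE x in haar. (\<lambda>n. f x * of_real (G n (character 1 x))) \<longlonglongrightarrow> f x * indicator U x"
    proof (rule AE_I2)
      fix x
      have "(indicator U x :: complex) = of_real (indicator U x)"
        by (simp split: split_indicator)
      then show "(\<lambda>n. f x * of_real (G n (character 1 x))) \<longlonglongrightarrow> f x * indicator U x"
        using lim[of x] by (auto intro!: tendsto_intros)
    qed
    show "AE x in haar. norm (f x * of_real (G n (character 1 x))) \<le> norm (f x)" for n
    proof (rule AE_I2)
      fix x
      have "\<bar>G n (character 1 x)\<bar> \<le> 1"
        by (simp add: G_def infdist_nonneg)
      then show "norm (f x * of_real (G n (character 1 x))) \<le> norm (f x)"
        by (simp add: norm_mult mult_left_le)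
    qed
  qed (use fi in auto)
  moreover have "(LINT x|haar. f x * of_real (G n (character 1 x))) = 0" for n
    by (rule fourier_null_continuous[OF f cont]) simp
  ultimately show ?thesis
    by (simp add: LIMSEQ_const_iff)
qed

text \<open>The sets over which \<open>f\<close> integrates to zero form a Dynkin system, which contains the open sets
  and therefore all Borel sets.\<close>
theorem fourier_null_AE_0:
  assumes f: "fourier_null f"
  shows "AE x in haar. f x = 0"
proof (rule haar.density_zero)
  show fi: "integrable haar f"
    using f by (simp add: fourier_null_def)
  fix A assume "A \<in> sets haar"
  then have A: "A \<in> sigma_sets UNIV {S. open S}"
    by (simp add: borel_def)
  have "Int_stable {S :: torus set. open S}" "{S :: torus set. open S} \<subseteq> Pow UNIV"
    by (auto simp: Int_stable_def)
  from this A show "(LINT x:A|haar. f x) = 0"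
  proof (induction rule: sigma_sets_induct_disjoint)
    case (basic A)
    have "(\<lambda>x. indicator A x *\<^sub>R f x) = (\<lambda>x. f x * indicator A x)"
      by (auto split: split_indicator)
    then show ?case
      using basic fourier_null_open[OF f, of A] by (simp add: set_lebesgue_integral_def)
  next
    case (compl A)
    then have A: "A \<in> sets haar" by (simp add: borel_def)
    have "(LINT x:UNIV - A|haar. f x) = (LINT x:UNIV|haar. f x) - (LINT x:A|haar. f x)"
      using fi A by (simp add: set_lebesgue_integral_def indicator_diff scaleR_diff_left
          integrable_mult_indicator)
    also have "(LINT x:UNIV|haar. f x) = 0"
      using fourier_null_open[OF f, of UNIV] by (simp add: set_lebesgue_integral_def)
    finally show ?case using compl by simp
  next
    case (union A)
    then have A: "A i \<in> sets haar" for i by (auto simp: borel_def)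
    have "(LINT x:(\<Union>i. A i)|haar. f x) = (\<Sum>i. LINT x:A i|haar. f x)"
      using A fi union(1)
      by (intro lebesgue_integral_countable_add)
        (auto simp: disjoint_family_on_def set_integrable_def intro!: integrable_mult_indicator)
    then show ?case using union by simp
  qed (simp_all add: set_lebesgue_integral_def)
qed

section \<open>Completeness of the space of square-integrable functions\<close>

lemma l2_torus_cases:
  obtains g where "square_integrable g" "f = abs_l2_torus g"
proof (rule that)
  show "square_integrable (rep_l2_torus f)"
    using Quotient_rep_reflp[OF Quotient_l2_torus, of f] by simp
  show "f = abs_l2_torus (rep_l2_torus f)"
    by (rule Quotient_abs_rep[OF Quotient_l2_torus, symmetric])
qed

lemma square_integrable_diff:
  "square_integrable f \<Longrightarrow> square_integrable g \<Longrightarrow> square_integrable (\<lambda>x. f x - g x)"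
  using square_integrable_add[of f "\<lambda>x. - 1 * g x"] square_integrable_cmult[of g "- 1"] by simp

lemma abs_l2_torus_diff:
  assumes "square_integrable f" "square_integrable g"
  shows "abs_l2_torus f - abs_l2_torus g = abs_l2_torus (\<lambda>x. f x - g x)"
  using assms square_integrable_cmult[of g "- 1"]
  by (simp add: minus_l2_torus_def uminus_l2_torus.abs_eq plus_l2_torus.abs_eq)

lemma norm_abs_l2_torus:
  assumes "square_integrable f"
  shows "(norm (abs_l2_torus f))\<^sup>2 = (LINT x|haar. (cmod (f x))\<^sup>2)"
proof -
  have "(norm (abs_l2_torus f))\<^sup>2 = inner (abs_l2_torus f) (abs_l2_torus f)"
    by (simp add: power2_norm_eq_inner)
  also have "\<dots> = (LINT x|haar. (cmod (f x))\<^sup>2)"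
    using assms
    by (simp add: inner_l2_torus.abs_eq flip: complex_norm_square del: of_real_power)
  finally show ?thesis .
qed

lemma integrable_of_square_integrable:
  assumes "square_integrable f" shows "integrable haar f"
  using square_integrable_mult_cnj[OF assms square_integrable_character[of 0]] by simp

text \<open>A bound of the mean by the quadratic mean, obtained by integrating
  \<open>\<bar>f\<bar> \<le> \<bar>f\<bar>\<^sup>2 / (2 * e) + e / 2\<close>; it holds because the measure has total mass one.\<close>
lemma integral_norm_le_of_L2:
  assumes f: "square_integrable f" and e: "e > 0" and le: "norm (abs_l2_torus f) \<le> e"
  shows "(LINT x|haar. cmod (f x)) \<le> e"
proof -
  have fi: "integrable haar (\<lambda>x. (cmod (f x))\<^sup>2)"
    using f by (simp add: square_integrable_def)
  have "(LINT x|haar. cmod (f x)) \<le> (LINT x|haar. (cmod (f x))\<^sup>2 / (2 * e) + e / 2)"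
  proof (rule integral_mono)
    show "cmod (f x) \<le> (cmod (f x))\<^sup>2 / (2 * e) + e / 2" for x
      using sum_squares_bound[of "cmod (f x)" e] e by (simp add: field_simps power2_eq_square)
  qed (use fi integrable_of_square_integrable[OF f] in auto)
  also have "\<dots> = (LINT x|haar. (cmod (f x))\<^sup>2) / (2 * e) + e / 2"
    using fi by (simp add: measure_def)
  also have "(LINT x|haar. (cmod (f x))\<^sup>2) \<le> e\<^sup>2"
    unfolding norm_abs_l2_torus[OF f, symmetric] using le by (intro power_mono) auto
  finally show ?thesis
    using e by (simp add: field_simps power2_eq_square)
qed

text \<open>Riesz-Fischer: along a subsequence whose consecutive distances are at most \<open>(1/2)^n\<close> the
  representatives have summable increments almost everywhere, so they converge pointwise. Fatou's
  lemma shows that the pointwise limit is also the limit in norm.\<close>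
instance l2_torus :: banach
proof
  fix X :: "nat \<Rightarrow> l2_torus" assume X: "Cauchy X"
  have "\<exists>r. \<forall>n. (\<forall>m\<ge>r n. dist (X m) (X (r n)) < (1/2)^n) \<and> r n < r (Suc n)"
  proof (rule dependent_nat_choice)
    have ex: "\<exists>N. \<forall>m\<ge>N. \<forall>n\<ge>N. dist (X m) (X n) < (1/2)^k" for k :: nat
      using X by (auto simp: Cauchy_def)
    show "\<exists>x. \<forall>m\<ge>x. dist (X m) (X x) < (1/2)^0"
      using ex[of 0] by blast
    fix x n
    obtain N where "\<forall>m\<ge>N. \<forall>m'\<ge>N. dist (X m) (X m') < (1/2)^Suc n"
      using ex[of "Suc n"] by blast
    then show "\<exists>y. (\<forall>m\<ge>y. dist (X m) (X y) < (1/2)^Suc n) \<and> x < y"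
      by (intro exI[of _ "max N (Suc x)"]) auto
  qed
  then obtain r where r: "\<And>n m. m \<ge> r n \<Longrightarrow> dist (X m) (X (r n)) < (1/2)^n"
    and "\<And>n. r n < r (Suc n)" by blast
  then have mono: "strict_mono r"
    by (simp add: strict_mono_Suc_iff)
  have "\<forall>n. \<exists>f. square_integrable f \<and> X (r n) = abs_l2_torus f"
    using l2_torus_cases by metis
  then obtain Y where Y: "\<And>n. square_integrable (Y n)" and XY: "\<And>n. X (r n) = abs_l2_torus (Y n)"
    by metis
  note [measurable] = square_integrable_measurable[OF Y]
  have YY: "norm (abs_l2_torus (\<lambda>x. Y m x - Y n x)) \<le> (1/2)^n" if "n \<le> m" for m n
    using less_imp_le[OF r[of n "r m"]] strict_mono_less_eq[OF mono, of n m] that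
    by (simp add: XY dist_norm abs_l2_torus_diff Y)
  define D where "D n x = cmod (Y (Suc n) x - Y n x)" for n x
  have [measurable]: "D n \<in> borel_measurable haar" for n
    unfolding D_def by measurable
  have D: "(\<integral>\<^sup>+x. ennreal (D n x) \<partial>haar) \<le> ennreal ((1/2)^n)" for n
  proof -
    have "(\<integral>\<^sup>+x. ennreal (D n x) \<partial>haar) = ennreal (LINT x|haar. D n x)"
      unfolding D_def using integrable_of_square_integrable[OF square_integrable_diff[OF Y Y]]
      by (intro nn_integral_eq_integral) auto
    also have "\<dots> \<le> ennreal ((1/2)^n)"
      unfolding D_def by (intro ennreal_leI integral_norm_le_of_L2 square_integrable_diff Y YY) auto
    finally show ?thesis .
  qed
  have "(\<integral>\<^sup>+x. (\<Sum>n. ennreal (D n x)) \<partial>haar) = (\<Sum>n. \<integral>\<^sup>+x. ennreal (D n x) \<partial>haar)"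
    by (rule nn_integral_suminf) simp
  also have "\<dots> \<le> (\<Sum>n. ennreal ((1/2)^n))"
    by (intro suminf_le D) auto
  also have "\<dots> < \<infinity>"
    by (simp add: suminf_ennreal2 summable_geometric less_top)
  finally have "AE x in haar. (\<Sum>n. ennreal (D n x)) \<noteq> \<infinity>"
    by (intro nn_integral_PInf_AE) auto
  then have conv: "AE x in haar. convergent (\<lambda>n. Y n x)"
  proof eventually_elim
    fix x assume "(\<Sum>n. ennreal (D n x)) \<noteq> \<infinity>"
    then have "summable (\<lambda>n. D n x)"
      by (intro summable_suminf_not_top) (auto simp: D_def)
    then have "summable (\<lambda>n. Y (Suc n) x - Y n x)"
      unfolding D_def by (rule summable_norm_cancel)
    then have "convergent (\<lambda>n. \<Sum>i<n. Y (Suc i) x - Y i x)"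
      by (simp add: summable_iff_convergent)
    then have "convergent (\<lambda>n. Y n x - Y 0 x)"
      by (simp add: sum_lessThan_telescope[of "\<lambda>n. Y n x"])
    from convergent_add[OF this convergent_const[of "Y 0 x"]] show "convergent (\<lambda>n. Y n x)"
      by simp
  qed
  define y where "y x = lim (\<lambda>n. Y n x)" for x
  have [measurable]: "y \<in> borel_measurable haar"
    unfolding y_def by measurable
  have fatou: "(\<integral>\<^sup>+x. ennreal ((cmod (y x - Y n x))\<^sup>2) \<partial>haar) \<le> ennreal (((1/2)^n)\<^sup>2)" for n
  proof -
    have "(\<integral>\<^sup>+x. ennreal ((cmod (y x - Y n x))\<^sup>2) \<partial>haar)
        = (\<integral>\<^sup>+x. liminf (\<lambda>m. ennreal ((cmod (Y m x - Y n x))\<^sup>2)) \<partial>haar)"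
    proof (rule nn_integral_cong_AE)
      show "AE x in haar. ennreal ((cmod (y x - Y n x))\<^sup>2)
          = liminf (\<lambda>m. ennreal ((cmod (Y m x - Y n x))\<^sup>2))"
        using conv
      proof eventually_elim
        fix x assume "convergent (\<lambda>n. Y n x)"
        then have "(\<lambda>m. Y m x) \<longlonglongrightarrow> y x"
          by (simp add: y_def convergent_LIMSEQ_iff)
        then have "(\<lambda>m. ennreal ((cmod (Y m x - Y n x))\<^sup>2)) \<longlonglongrightarrow> ennreal ((cmod (y x - Y n x))\<^sup>2)"
          by (intro tendsto_intros)
        then show "ennreal ((cmod (y x - Y n x))\<^sup>2) = liminf (\<lambda>m. ennreal ((cmod (Y m x - Y n x))\<^sup>2))"
          by (rule lim_imp_Liminf[OF sequentially_bot, symmetric])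
      qed
    qed
    also have "\<dots> \<le> liminf (\<lambda>m. \<integral>\<^sup>+x. ennreal ((cmod (Y m x - Y n x))\<^sup>2) \<partial>haar)"
      by (rule nn_integral_liminf) simp
    also have "\<dots> \<le> liminf (\<lambda>m. ennreal (((1/2)^n)\<^sup>2))"
    proof (rule Liminf_mono)
      show "\<forall>\<^sub>F m in sequentially. (\<integral>\<^sup>+x. ennreal ((cmod (Y m x - Y n x))\<^sup>2) \<partial>haar) \<le> ennreal (((1/2)^n)\<^sup>2)"
        using eventually_ge_at_top[of n]
      proof eventually_elim
        fix m assume "n \<le> m"
        have sq: "square_integrable (\<lambda>x. Y m x - Y n x)"
          by (intro square_integrable_diff Y)
        then have "(\<integral>\<^sup>+x. ennreal ((cmod (Y m x - Y n x))\<^sup>2) \<partial>haar)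
            = ennreal ((norm (abs_l2_torus (\<lambda>x. Y m x - Y n x)))\<^sup>2)"
          unfolding norm_abs_l2_torus[OF sq]
          by (intro nn_integral_eq_integral) (auto simp: square_integrable_def)
        also have "\<dots> \<le> ennreal (((1/2)^n)\<^sup>2)"
          using YY[OF \<open>n \<le> m\<close>] by (intro ennreal_leI power_mono) auto
        finally show "(\<integral>\<^sup>+x. ennreal ((cmod (Y m x - Y n x))\<^sup>2) \<partial>haar) \<le> ennreal (((1/2)^n)\<^sup>2)" .
      qed
    qed
    finally show ?thesis
      by (simp add: Liminf_const)
  qed
  have yY: "square_integrable (\<lambda>x. y x - Y n x)" for n
  proof -
    have "integrable haar (\<lambda>x. (cmod (y x - Y n x))\<^sup>2)"
      using fatou[of n] by (intro integrableI_bounded) (auto intro: le_less_trans)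
    then show ?thesis by (simp add: square_integrable_def)
  qed
  have y: "square_integrable y"
    using square_integrable_add[OF yY[of 0] Y[of 0]] by simp
  have le: "dist (X (r n)) (abs_l2_torus y) \<le> (1/2)^n" for n
  proof -
    have "ennreal ((norm (abs_l2_torus (\<lambda>x. y x - Y n x)))\<^sup>2) \<le> ennreal (((1/2)^n)\<^sup>2)"
      using fatou[of n] yY[of n] unfolding norm_abs_l2_torus[OF yY]
      by (subst (asm) nn_integral_eq_integral) (auto simp: square_integrable_def)
    then have "norm (abs_l2_torus (\<lambda>x. y x - Y n x)) \<le> (1/2)^n"
      by (auto simp: ennreal_le_iff intro: power2_le_imp_le)
    then show ?thesis
      by (simp add: dist_commute dist_norm XY abs_l2_torus_diff y Y)
  qed
  have "(\<lambda>n. X (r n)) \<longlonglongrightarrow> abs_l2_torus y"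
  proof (rule metric_tendsto_imp_tendsto[where f="\<lambda>n. (1/2::real)^n" and a=0])
    show "(\<lambda>n. (1/2::real)^n) \<longlonglongrightarrow> 0"
      by (rule LIMSEQ_realpow_zero) auto
  qed (use le in auto)
  then have "X \<longlonglongrightarrow> abs_l2_torus y"
    by (intro Cauchy_converges_subseq[OF X mono]) (simp add: o_def)
  then show "convergent X"
    by (rule convergentI)
qed

section \<open>Fourier coefficients in the Hilbert space\<close>

lemma integrable_mult_character:
  "square_integrable f \<Longrightarrow> integrable haar (\<lambda>x. f x * character k x)"
  using square_integrable_mult_cnj[OF _ square_integrable_character[of "- k"]]
  by (simp add: cnj_character)

lemma fourier_add: "fourier (f + g) k = fourier f k + fourier g k"
  by transfer (simp add: fourier_coeff_def distrib_right integrable_mult_character)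

lemma fourier_scaleC: "fourier (c *\<^sub>C f) k = c * fourier f k"
  by transfer (simp add: fourier_coeff_def mult.assoc)

lemma scaleR_eq_scaleC: "r *\<^sub>R f = complex_of_real r *\<^sub>C f"
  by transfer (auto intro: square_integrable_cmult)

lemma fourier_scaleR: "fourier (r *\<^sub>R f) k = r *\<^sub>R fourier f k"
  by (simp add: scaleR_eq_scaleC fourier_scaleC scaleR_conv_of_real)

lemma fourier_exponential: "fourier (exponential j) k = (if j = k then 1 else 0)"
  by transfer (rule fourier_coeff_character)

text \<open>The inner product of the real Hilbert space only sees real parts. Letting the coefficient \<open>c\<close>
  range over the complex numbers recovers the whole Fourier coefficient.\<close>
lemma inner_exponential: "inner f (c *\<^sub>C exponential k) = Re (cnj c * fourier f k)"
proof transfer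
  fix f and c :: complex and k
  have "(LINT x|haar. f x * cnj (c * character k x)) = (LINT x|haar. cnj c * (f x * character (- k) x))"
    by (intro Bochner_Integration.integral_cong) (simp_all add: cnj_character mult_ac)
  then show "Re (LINT x|haar. f x * cnj (c * character k x)) = Re (cnj c * fourier_coeff f k)"
    by (simp add: fourier_coeff_def)
qed

lemma norm_scaleC_exponential [simp]: "norm (c *\<^sub>C exponential k) = cmod c"
proof -
  have "(norm (c *\<^sub>C exponential k))\<^sup>2 = (cmod c)\<^sup>2"
    unfolding power2_norm_eq_inner[of "c *\<^sub>C exponential k"]
    by (simp add: inner_exponential fourier_scaleC fourier_exponential cmod_power2 flip: power2_eq_square)
  then show ?thesis by simp
qed

lemma cmod_fourier_le: "cmod (fourier f k) \<le> norm f"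
proof -
  define c where "c = sgn (fourier f k)"
  have "cmod (fourier f k) = Re (cnj c * fourier f k)"
    by (cases "fourier f k = 0")
      (simp_all add: c_def sgn_eq complex_norm_square[symmetric] mult.commute power2_eq_square field_simps flip: of_real_mult)
  also have "\<dots> \<le> norm f * norm (c *\<^sub>C exponential k)"
    by (metis inner_exponential norm_cauchy_schwarz)
  also have "\<dots> \<le> norm f * 1"
    by (intro mult_left_mono) (simp_all add: c_def norm_sgn)
  finally show ?thesis by simp
qed

lemma bounded_linear_fourier: "bounded_linear (\<lambda>f. fourier f k)"
  by (rule bounded_linear_intro[where K=1])
    (simp_all add: fourier_add fourier_scaleR cmod_fourier_le)

lemma fourier_0 [simp]: "fourier 0 k = 0"
  by (rule linear_0[OF bounded_linear.linear[OF bounded_linear_fourier]])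

lemma fourier_diff: "fourier (f - g) k = fourier f k - fourier g k"
  by (rule linear_diff[OF bounded_linear.linear[OF bounded_linear_fourier]])

lemma fourier_sum: "fourier (sum f A) k = (\<Sum>a\<in>A. fourier (f a) k)"
  by (rule linear_sum[OF bounded_linear.linear[OF bounded_linear_fourier]])

lemma fourier_inject:
  assumes "\<And>k. fourier f k = fourier g k" shows "f = g"
proof -
  obtain h where h: "square_integrable h" "f - g = abs_l2_torus h"
    by (rule l2_torus_cases)
  have "fourier_coeff h k = 0" for k
    using assms[of k] fourier_diff[of f g k] h by (simp add: fourier.abs_eq)
  then have "AE x in haar. h x = 0"
    using h by (intro fourier_null_AE_0) (simp add: fourier_null_def integrable_of_square_integrable)
  then have "abs_l2_torus h = 0"
    unfolding zero_l2_torus_def using h square_integrable_0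
    by (intro Quotient_rel_abs[OF Quotient_l2_torus]) simp
  then show ?thesis
    using h by simp
qed

definition trig_sum :: "int set \<Rightarrow> (int \<Rightarrow> complex) \<Rightarrow> l2_torus" where
  "trig_sum F c = (\<Sum>k\<in>F. c k *\<^sub>C exponential k)"

lemma fourier_trig_sum:
  "finite F \<Longrightarrow> fourier (trig_sum F c) k = (if k \<in> F then c k else 0)"
  by (simp add: trig_sum_def fourier_sum fourier_scaleC fourier_exponential if_distrib cong: if_cong)

lemma inner_trig_sum: "inner f (trig_sum F c) = (\<Sum>k\<in>F. Re (cnj (c k) * fourier f k))"
  by (simp add: trig_sum_def inner_sum_right inner_exponential)

lemma norm_trig_sum:
  assumes "finite F" shows "(norm (trig_sum F c))\<^sup>2 = (\<Sum>k\<in>F. (cmod (c k))\<^sup>2)"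
  unfolding power2_norm_eq_inner[of "trig_sum F c"] using assms
  by (simp add: inner_trig_sum fourier_trig_sum cmod_power2 flip: power2_eq_square)

text \<open>Bessel's inequality: subtracting the Fourier polynomial lowers the squared norm by exactly the
  sum on the left.\<close>
lemma fourier_Bessel:
  assumes "finite F" shows "(\<Sum>k\<in>F. (cmod (fourier f k))\<^sup>2) \<le> (norm f)\<^sup>2"
proof -
  let ?P = "trig_sum F (fourier f)"
  have "inner f ?P = (norm ?P)\<^sup>2"
    using assms by (simp add: norm_trig_sum inner_trig_sum cmod_power2 flip: power2_eq_square)
  then have "(norm (f - ?P))\<^sup>2 = (norm f)\<^sup>2 - (norm ?P)\<^sup>2"
    by (simp add: power2_norm_eq_inner inner_diff_left inner_diff_right inner_commute)
  then show ?thesis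
    using norm_trig_sum[OF assms, of "fourier f"] zero_le_power2[of "norm (f - ?P)"] by linarith
qed

text \<open>Symmetric partial sums turn the convergence of Fourier series into convergence of sequences.\<close>
definition fourier_partial :: "l2_torus \<Rightarrow> nat \<Rightarrow> l2_torus" where
  "fourier_partial f N = trig_sum {- int N..int N} (fourier f)"

lemma fourier_fourier_partial:
  "fourier (fourier_partial f N) k = (if \<bar>k\<bar> \<le> int N then fourier f k else 0)"
  by (auto simp: fourier_partial_def fourier_trig_sum)

lemma norm_fourier_partial_diff:
  assumes "M \<le> N"
  shows "(norm (fourier_partial f N - fourier_partial f M))\<^sup>2
     = (\<Sum>k\<in>{- int N..int N} - {- int M..int M}. (cmod (fourier f k))\<^sup>2)"
proof -
  have "fourier_partial f N - fourier_partial f M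
      = trig_sum ({- int N..int N} - {- int M..int M}) (fourier f)"
    using assms by (intro fourier_inject) (auto simp: fourier_diff fourier_fourier_partial fourier_trig_sum)
  then show ?thesis
    by (simp add: norm_trig_sum)
qed

text \<open>By Bessel's inequality the partial sums form a Cauchy sequence. Their limit has the same Fourier
  coefficients as \<open>f\<close>, so uniqueness identifies it.\<close>
theorem fourier_partial_tendsto: "fourier_partial f \<longlonglongrightarrow> f"
proof -
  define s where "s N = (\<Sum>k\<in>{- int N..int N}. (cmod (fourier f k))\<^sup>2)" for N
  have diff: "(norm (fourier_partial f N - fourier_partial f M))\<^sup>2 = s N - s M" if "M \<le> N" for M N
    unfolding norm_fourier_partial_diff[OF that] s_def using that by (intro sum_diff) auto
  have "incseq s"
    unfolding incseq_def s_def by (intro allI impI sum_mono2) auto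
  moreover have "s N \<le> (norm f)\<^sup>2" for N
    by (simp add: s_def fourier_Bessel)
  ultimately have "convergent s"
    by (metis incseq_convergent convergentI)
  then have sC: "Cauchy s"
    by (rule convergent_Cauchy)
  have "Cauchy (fourier_partial f)"
  proof (rule CauchyI')
    fix e :: real assume "e > 0"
    then obtain K where K: "\<And>m n. m \<ge> K \<Longrightarrow> n \<ge> K \<Longrightarrow> dist (s m) (s n) < e\<^sup>2"
      using sC unfolding Cauchy_def by (meson zero_less_power)
    show "\<exists>M. \<forall>m\<ge>M. \<forall>n>m. dist (fourier_partial f m) (fourier_partial f n) < e"
    proof (intro exI allI impI)
      fix m n assume "m \<ge> K" "n > m"
      then have "(norm (fourier_partial f n - fourier_partial f m))\<^sup>2 < e\<^sup>2"
        using K[of n m] diff[of m n] by (auto simp: dist_real_def)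
      then show "dist (fourier_partial f m) (fourier_partial f n) < e"
        using \<open>e > 0\<close> by (simp add: dist_norm norm_minus_commute power2_less_imp_less)
    qed
  qed
  then obtain g where g: "fourier_partial f \<longlonglongrightarrow> g"
    using Cauchy_convergent convergent_def by blast
  have "fourier g k = fourier f k" for k
  proof (rule LIMSEQ_unique)
    show "(\<lambda>N. fourier (fourier_partial f N) k) \<longlonglongrightarrow> fourier g k"
      by (rule bounded_linear.tendsto[OF bounded_linear_fourier g])
    show "(\<lambda>N. fourier (fourier_partial f N) k) \<longlonglongrightarrow> fourier f k"
      by (rule tendsto_eventually)
        (auto simp: fourier_fourier_partial eventually_sequentially intro!: exI[of _ "nat \<bar>k\<bar>"])
  qed
  then have "g = f" by (rule fourier_inject)
  with g show ?thesis by simp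
qed

lemma scaleC_exponential_in_trig_polys: "c *\<^sub>C exponential k \<in> trig_polys"
  unfolding trig_polys_def by (intro complex_l2.span_scale complex_l2.span_base) auto

lemma finite_fourier_support:
  assumes "f \<in> trig_polys" shows "finite {k. fourier f k \<noteq> 0}"
  using assms unfolding trig_polys_def
proof (induction rule: complex_l2.span_induct_alt)
  case base
  then show ?case by simp
next
  case (step c e f)
  then obtain j where "e = exponential j" by auto
  then have "{k. fourier (c *\<^sub>C e + f) k \<noteq> 0} \<subseteq> {j} \<union> {k. fourier f k \<noteq> 0}"
    by (auto simp: fourier_add fourier_scaleC fourier_exponential)
  with step show ?case by (auto intro: finite_subset)
qed

lemma trig_polys_eq_trig_sum:
  assumes "finite F" "{k. fourier f k \<noteq> 0} \<subseteq> F"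
  shows "f = trig_sum F (fourier f)"
  using assms by (intro fourier_inject) (auto simp: fourier_trig_sum)

section \<open>Diagonally dominant symbols\<close>

lemma norm_scaleC: "norm (a *\<^sub>C f) = cmod a * norm f"
proof -
  obtain h where h: "square_integrable h" "f = abs_l2_torus h"
    by (rule l2_torus_cases)
  then have "(norm (a *\<^sub>C f))\<^sup>2 = (cmod a * norm f)\<^sup>2"
    by (simp add: scaleC.abs_eq norm_abs_l2_torus square_integrable_cmult norm_mult power_mult_distrib)
  then show ?thesis by simp
qed

text \<open>On Fourier coefficients of trigonometric polynomials the operator acts as the infinite matrix of
  the symbol: the \<open>j\<close>-th coefficient of \<open>\<sigma>(\<cdot>, k) e\<^sub>k\<close> is the coefficient of \<open>\<sigma>(\<cdot>, k)\<close> at \<open>j - k\<close>.\<close>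
lemma fourier_pseudo_diff:
  assumes \<sigma>: "l2_symbol \<sigma>" and F: "finite F" "{k. fourier f k \<noteq> 0} \<subseteq> F"
  shows "fourier (pseudo_diff \<sigma> f) j = (\<Sum>k\<in>F. symbol_matrix \<sigma> j k * fourier f k)"
proof -
  have sq: "square_integrable (\<lambda>x. \<sigma> x k)" for k
    using \<sigma> by (simp add: l2_symbol_def)
  have sqk: "square_integrable (\<lambda>x. \<sigma> x k * fourier f k * character k x)" for k
  proof -
    have "square_integrable (\<lambda>x. fourier f k * \<sigma> x k)"
      by (intro square_integrable_cmult sq)
    then show ?thesis
      by (auto simp: square_integrable_def norm_mult mult.commute)
  qed
  have sum: "square_integrable (\<lambda>x. \<Sum>k\<in>F. \<sigma> x k * fourier f k * character k x)"
    using F(1) by induction (auto intro: square_integrable_0 square_integrable_add sqk)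
  have "(\<Sum>\<^sub>\<infinity>k. \<sigma> x k * fourier f k * character k x) = (\<Sum>k\<in>F. \<sigma> x k * fourier f k * character k x)" for x
  proof -
    have "(\<Sum>\<^sub>\<infinity>k. \<sigma> x k * fourier f k * character k x)
        = (\<Sum>\<^sub>\<infinity>k\<in>F. \<sigma> x k * fourier f k * character k x)"
      using F by (intro infsum_cong_neutral) auto
    then show ?thesis using F by simp
  qed
  then have "fourier (pseudo_diff \<sigma> f) j
      = fourier_coeff (\<lambda>x. \<Sum>k\<in>F. \<sigma> x k * fourier f k * character k x) j"
    using sum by (simp add: pseudo_diff_def fourier.abs_eq)
  also have "\<dots> = (\<Sum>k\<in>F. LINT x|haar. \<sigma> x k * fourier f k * character k x * character (- j) x)"
    unfolding fourier_coeff_def sum_distrib_right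
    by (intro Bochner_Integration.integral_sum integrable_mult_character sqk)
  also have "\<dots> = (\<Sum>k\<in>F. symbol_matrix \<sigma> j k * fourier f k)"
  proof (rule sum.cong[OF refl])
    fix k
    have "(LINT x|haar. \<sigma> x k * fourier f k * character k x * character (- j) x)
        = (LINT x|haar. fourier f k * (\<sigma> x k * character (- (j - k)) x))"
      using character_add[of k "- j"] by (intro Bochner_Integration.integral_cong) (simp_all add: mult_ac)
    then show "(LINT x|haar. \<sigma> x k * fourier f k * character k x * character (- j) x)
        = symbol_matrix \<sigma> j k * fourier f k"
      by (simp add: symbol_matrix_def symbol_hat_def fourier_coeff_def mult.commute)
  qed
  finally show ?thesis .
qed

lemma infdist_lessE:
  assumes "infdist x A < e" "A \<noteq> {}"
  obtains a where "a \<in> A" "dist x a < e"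
  using assms by (auto simp: infdist_notempty cINF_less_iff)

text \<open>Finite sums are enough to state dominance, because the absolute summability of rows and columns
  follows from them. The larger of the two suprema serves as the common ratio \<open>q\<close>.\<close>
locale diagonally_dominant_symbol =
  fixes \<sigma> :: "torus \<Rightarrow> int \<Rightarrow> complex" and q c :: real
  assumes \<sigma>: "l2_symbol \<sigma>"
    and q: "0 \<le> q" "q < 1"
    and c: "0 < c" "\<And>k. c \<le> cmod (symbol_matrix \<sigma> k k)"
    and col: "\<And>k F. finite F \<Longrightarrow> k \<notin> F \<Longrightarrow>
      (\<Sum>j\<in>F. cmod (symbol_matrix \<sigma> j k)) \<le> q * cmod (symbol_matrix \<sigma> k k)"
    and row: "\<And>j F. finite F \<Longrightarrow> j \<notin> F \<Longrightarrow>
      (\<Sum>k\<in>F. cmod (symbol_matrix \<sigma> j k)) \<le> q * cmod (symbol_matrix \<sigma> j j)"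
begin

abbreviation "M \<equiv> symbol_matrix \<sigma>"

lemma diag_pos: "cmod (M k k) > 0"
  using c less_le_trans by blast

lemma diag_nonzero: "M k k \<noteq> 0"
  using diag_pos[of k] by auto

subsection \<open>The maximal operator\<close>

lemma row_summable: "(\<lambda>k. cmod (M j k)) summable_on UNIV"
proof (rule nonneg_bdd_above_summable_on)
  show "bdd_above (sum (\<lambda>k. cmod (M j k)) ` {F. F \<subseteq> UNIV \<and> finite F})"
  proof (rule bdd_aboveI2)
    fix F :: "int set" assume "F \<in> {F. F \<subseteq> UNIV \<and> finite F}"
    then have F: "finite F" by simp
    then have "(\<Sum>k\<in>F. cmod (M j k)) \<le> (\<Sum>k\<in>insert j (F - {j}). cmod (M j k))"
      by (intro sum_mono2) auto
    also have "\<dots> \<le> cmod (M j j) + q * cmod (M j j)"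
      using F row[of "F - {j}" j] by (subst sum.insert) auto
    finally show "(\<Sum>k\<in>F. cmod (M j k)) \<le> cmod (M j j) + q * cmod (M j j)" .
  qed
qed simp

text \<open>Since rows are absolutely summable and Fourier coefficients are bounded by the norm, each row of
  the matrix is a bounded functional on the whole space. The maximal graph is thus cut out by
  equations between continuous functions.\<close>
definition matrix_row :: "int \<Rightarrow> l2_torus \<Rightarrow> complex" where
  "matrix_row j f = (\<Sum>\<^sub>\<infinity>k. M j k * fourier f k)"

lemma matrix_row_abs_summable: "(\<lambda>k. norm (M j k * fourier f k)) summable_on UNIV"
proof (rule Infinite_Sum.abs_summable_on_comparison_test')
  show "(\<lambda>k. cmod (M j k) * norm f) summable_on UNIV"
    by (intro summable_on_cmult_left row_summable)
qed (simp add: norm_mult mult_left_mono cmod_fourier_le)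

lemma matrix_row_summable: "(\<lambda>k. M j k * fourier f k) summable_on UNIV"
  by (rule abs_summable_summable[OF matrix_row_abs_summable])

lemma matrix_row_add: "matrix_row j (f + g) = matrix_row j f + matrix_row j g"
  unfolding matrix_row_def fourier_add distrib_left
  by (intro infsum_add matrix_row_summable)

lemma matrix_row_scaleC: "matrix_row j (a *\<^sub>C f) = a * matrix_row j f"
  unfolding matrix_row_def fourier_scaleC
  by (simp add: mult.left_commute infsum_cmult_right')

lemma bounded_linear_matrix_row: "bounded_linear (matrix_row j)"
proof (rule bounded_linear_intro[where K="\<Sum>\<^sub>\<infinity>k. cmod (M j k)"])
  fix f
  have "norm (matrix_row j f) \<le> (\<Sum>\<^sub>\<infinity>k. norm (M j k * fourier f k))"
    unfolding matrix_row_def by (rule norm_infsum_bound[OF matrix_row_abs_summable])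
  also have "\<dots> \<le> (\<Sum>\<^sub>\<infinity>k. cmod (M j k) * norm f)"
    by (intro infsum_mono matrix_row_abs_summable summable_on_cmult_left row_summable)
      (simp add: norm_mult mult_left_mono cmod_fourier_le)
  also have "\<dots> = norm f * (\<Sum>\<^sub>\<infinity>k. cmod (M j k))"
    by (simp add: infsum_cmult_right' mult.commute)
  finally show "norm (matrix_row j f) \<le> norm f * (\<Sum>\<^sub>\<infinity>k. cmod (M j k))" .
qed (simp_all add: matrix_row_add matrix_row_scaleC scaleR_eq_scaleC scaleR_conv_of_real)

lemma maximal_graph_iff: "(f, g) \<in> maximal_graph \<sigma> \<longleftrightarrow> (\<forall>j. matrix_row j f = fourier g j)"
proof -
  have "((\<lambda>k. M j k * fourier f k) has_sum x) UNIV \<longleftrightarrow> matrix_row j f = x" for j x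
    using has_sum_infsum[OF matrix_row_summable] infsumI unfolding matrix_row_def by metis
  then show ?thesis
    by (simp add: maximal_graph_def)
qed

lemma matrix_row_split:
  "matrix_row j f = M j j * fourier f j + (\<Sum>\<^sub>\<infinity>k\<in>- {j}. M j k * fourier f k)"
proof -
  have "(\<lambda>k. M j k * fourier f k) summable_on - {j}"
    by (rule summable_on_subset_banach[OF matrix_row_summable]) simp
  then show ?thesis
    using infsum_Un_disjoint[of "\<lambda>k. M j k * fourier f k" "{j}" "- {j}"]
    by (simp add: matrix_row_def)
qed

text \<open>By row dominance, in the equation of row \<open>j\<close> the diagonal term can only be cancelled if
  \<open>\<bar>fourier f j\<bar> \<le> q * s\<close>, where \<open>s\<close> is the supremum of all \<open>\<bar>fourier f k\<bar>\<close>; hence \<open>s \<le> q * s\<close>.\<close>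
lemma maximal_injective:
  assumes "\<And>j. matrix_row j f = 0" shows "f = 0"
proof -
  define s where "s = (SUP j. cmod (fourier f j))"
  have bdd: "bdd_above (range (\<lambda>j. cmod (fourier f j)))"
    by (rule bdd_aboveI2[where M="norm f"]) (rule cmod_fourier_le)
  have s: "cmod (fourier f j) \<le> s" for j
    unfolding s_def by (rule cSUP_upper[OF _ bdd]) simp
  have "cmod (fourier f j) \<le> q * s" for j
  proof -
    have rs: "(\<lambda>k. cmod (M j k)) summable_on - {j}"
      by (rule summable_on_subset_banach[OF row_summable]) simp
    have as: "(\<lambda>k. norm (M j k * fourier f k)) summable_on - {j}"
      by (rule summable_on_subset_banach[OF matrix_row_abs_summable]) simp
    have "M j j * fourier f j = - (\<Sum>\<^sub>\<infinity>k\<in>- {j}. M j k * fourier f k)"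
      using matrix_row_split[of j f] assms[of j] by (simp add: eq_neg_iff_add_eq_0)
    then have "cmod (M j j) * cmod (fourier f j) = cmod (\<Sum>\<^sub>\<infinity>k\<in>- {j}. M j k * fourier f k)"
      by (simp flip: norm_mult)
    also have "\<dots> \<le> (\<Sum>\<^sub>\<infinity>k\<in>- {j}. norm (M j k * fourier f k))"
      by (rule norm_infsum_bound[OF as])
    also have "\<dots> \<le> (\<Sum>\<^sub>\<infinity>k\<in>- {j}. cmod (M j k) * s)"
      by (intro infsum_mono as summable_on_cmult_left rs) (simp add: norm_mult mult_left_mono s)
    also have "\<dots> = (\<Sum>\<^sub>\<infinity>k\<in>- {j}. cmod (M j k)) * s"
      by (rule infsum_cmult_left')
    also have "\<dots> \<le> (q * cmod (M j j)) * s"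
    proof (rule mult_right_mono)
      show "(\<Sum>\<^sub>\<infinity>k\<in>- {j}. cmod (M j k)) \<le> q * cmod (M j j)"
        using row by (intro infsum_le_finite_sums rs) auto
      show "0 \<le> s"
        using s[of 0] norm_ge_zero[of "fourier f 0"] by linarith
    qed
    finally have "cmod (M j j) * cmod (fourier f j) \<le> cmod (M j j) * (q * s)"
      by (simp add: mult_ac)
    then show ?thesis
      using diag_pos[of j] by (simp only: mult_le_cancel_left_pos)
  qed
  then have "s \<le> q * s"
    unfolding s_def by (intro cSUP_least) auto
  then have "(1 - q) * s \<le> 0"
    by (simp add: algebra_simps)
  then have "s \<le> 0"
    using q by (simp add: mult_le_0_iff)
  then have "fourier f k = 0" for k
    using s[of k] by (metis norm_le_zero_iff order_trans)
  then show ?thesis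
    by (intro fourier_inject) simp
qed

lemma closed_maximal_graph: "closed (maximal_graph \<sigma>)"
proof -
  have eq: "maximal_graph \<sigma> = (\<Inter>j. {p. matrix_row j (fst p) = fourier (snd p) j})"
    by (auto simp: maximal_graph_iff)
  show ?thesis
    unfolding eq
    by (intro closed_INT ballI closed_Collect_eq
        bounded_linear.continuous_on[OF bounded_linear_matrix_row]
        bounded_linear.continuous_on[OF bounded_linear_fourier] continuous_intros)
qed

lemma maximal_graph_right_unique:
  assumes "(f, g) \<in> maximal_graph \<sigma>" "(f, g') \<in> maximal_graph \<sigma>" shows "g = g'"
  using assms by (intro fourier_inject) (simp add: maximal_graph_iff)

lemma maximal_graph_left_unique:
  assumes "(f, g) \<in> maximal_graph \<sigma>" "(f', g) \<in> maximal_graph \<sigma>" shows "f = f'"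
proof -
  have "f - f' = 0"
    using assms
    by (intro maximal_injective)
      (simp add: linear_diff[OF bounded_linear.linear[OF bounded_linear_matrix_row]] maximal_graph_iff)
  then show ?thesis by simp
qed

lemma linear_maximal_graph: "linear_operator (maximal_graph \<sigma>)"
  unfolding linear_operator_def single_valued_def
  using maximal_graph_right_unique
  by (auto simp: maximal_graph_iff matrix_row_add matrix_row_scaleC fourier_add fourier_scaleC
      linear_0[OF bounded_linear.linear[OF bounded_linear_matrix_row]])

lemma minimal_subset_maximal: "minimal_graph \<sigma> \<subseteq> maximal_graph \<sigma>"
proof
  fix p assume "p \<in> minimal_graph \<sigma>"
  then obtain f where p: "p = (f, pseudo_diff \<sigma> f)" and f: "f \<in> trig_polys"
    by (auto simp: minimal_graph_def)
  define F where "F = {k. fourier f k \<noteq> 0}"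
  have F: "finite F"
    unfolding F_def by (rule finite_fourier_support[OF f])
  have "matrix_row j f = fourier (pseudo_diff \<sigma> f) j" for j
  proof -
    have "matrix_row j f = (\<Sum>\<^sub>\<infinity>k\<in>F. M j k * fourier f k)"
      unfolding matrix_row_def by (intro infsum_cong_neutral) (auto simp: F_def)
    then show ?thesis
      using fourier_pseudo_diff[OF \<sigma> F] F by (simp add: F_def)
  qed
  then show "p \<in> maximal_graph \<sigma>"
    by (simp add: p maximal_graph_iff)
qed

subsection \<open>The a priori bound\<close>

text \<open>Splitting \<open>u j * u k \<le> ((u j)\<^sup>2 + (u k)\<^sup>2) / 2\<close> distributes the off-diagonal part evenly over rows and
  columns, so that the two dominance conditions each control one half of it.\<close>
lemma off_diagonal_form_bound:
  fixes u :: "int \<Rightarrow> real"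
  assumes F: "finite F"
  shows "(\<Sum>j\<in>F. \<Sum>k\<in>F - {j}. cmod (M j k) * (u j * u k)) \<le> q * (\<Sum>j\<in>F. cmod (M j j) * (u j)\<^sup>2)"
proof -
  have "(\<Sum>j\<in>F. \<Sum>k\<in>F - {j}. cmod (M j k) * (u j * u k))
      \<le> (\<Sum>j\<in>F. \<Sum>k\<in>F - {j}. cmod (M j k) * (u j)\<^sup>2 / 2 + cmod (M j k) * (u k)\<^sup>2 / 2)"
  proof (intro sum_mono)
    fix j k
    have "u j * u k \<le> ((u j)\<^sup>2 + (u k)\<^sup>2) / 2"
      using sum_squares_bound[of "u j" "u k"] by simp
    from mult_left_mono[OF this norm_ge_zero[of "M j k"]]
    show "cmod (M j k) * (u j * u k) \<le> cmod (M j k) * (u j)\<^sup>2 / 2 + cmod (M j k) * (u k)\<^sup>2 / 2"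
      by (simp add: distrib_left add_divide_distrib)
  qed
  also have "\<dots> = (\<Sum>j\<in>F. \<Sum>k\<in>F - {j}. cmod (M j k) * (u j)\<^sup>2 / 2)
      + (\<Sum>j\<in>F. \<Sum>k\<in>F - {j}. cmod (M j k) * (u k)\<^sup>2 / 2)"
    by (simp add: sum.distrib)
  also have "(\<Sum>j\<in>F. \<Sum>k\<in>F - {j}. cmod (M j k) * (u k)\<^sup>2 / 2)
      = (\<Sum>k\<in>F. \<Sum>j\<in>F - {k}. cmod (M j k) * (u k)\<^sup>2 / 2)"
  proof -
    have "F - {j} = {k \<in> F. j \<noteq> k}" "F - {j} = {k \<in> F. k \<noteq> j}" for j
      by auto
    then show ?thesis
      using sum.swap_restrict[OF F F, of "\<lambda>j k. cmod (M j k) * (u k)\<^sup>2 / 2" "(\<noteq>)"] by simp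
  qed
  also have "(\<Sum>j\<in>F. \<Sum>k\<in>F - {j}. cmod (M j k) * (u j)\<^sup>2 / 2)
      \<le> (\<Sum>j\<in>F. q * cmod (M j j) * (u j)\<^sup>2 / 2)"
    using F row by (intro sum_mono)
      (auto simp: simp flip: sum_distrib_right sum_divide_distrib intro!: mult_right_mono)
  also have "(\<Sum>k\<in>F. \<Sum>j\<in>F - {k}. cmod (M j k) * (u k)\<^sup>2 / 2)
      \<le> (\<Sum>k\<in>F. q * cmod (M k k) * (u k)\<^sup>2 / 2)"
    using F col by (intro sum_mono)
      (auto simp: simp flip: sum_distrib_right sum_divide_distrib intro!: mult_right_mono)
  finally show ?thesis
    by (simp add: sum_distrib_left mult.assoc flip: sum.distrib)
qed

text \<open>Coercivity. Pairing the image of \<open>f\<close> with the function whose coefficients are those of \<open>f\<close>,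
  rotated by the phases of the diagonal, turns the diagonal part into a positive quadratic form,
  of which the off-diagonal part takes away at most the fraction \<open>q\<close>. The weights \<open>\<bar>M j j\<bar>\<close> are kept,
  because their growth is what makes the inverse compact.\<close>
lemma energy_trig:
  assumes "f \<in> trig_polys" and F: "finite F"
  shows "(1 - q) * (\<Sum>j\<in>F. cmod (M j j) * (cmod (fourier f j))\<^sup>2) \<le> norm f * norm (pseudo_diff \<sigma> f)"
proof -
  define G where "G = F \<union> {k. fourier f k \<noteq> 0}"
  have G: "finite G" "{k. fourier f k \<noteq> 0} \<subseteq> G"
    using F finite_fourier_support[OF assms(1)] by (auto simp: G_def)
  define g where "g = pseudo_diff \<sigma> f"
  define u where "u j = cmod (fourier f j)" for j
  define w where "w j = sgn (M j j) * fourier f j" for j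
  have fg: "fourier g j = M j j * fourier f j + (\<Sum>k\<in>G - {j}. M j k * fourier f k)" if "j \<in> G" for j
    unfolding g_def fourier_pseudo_diff[OF \<sigma> G] using G that by (simp add: sum.remove)
  have u: "cmod (w j) = u j" for j
    using diag_nonzero[of j] by (simp add: w_def u_def norm_mult norm_sgn)
  have "f = trig_sum G (fourier f)"
    by (rule trig_polys_eq_trig_sum[OF G])
  then have "(norm f)\<^sup>2 = (\<Sum>k\<in>G. (u k)\<^sup>2)"
    unfolding u_def using norm_trig_sum[OF G(1), of "fourier f"] by simp
  then have "(norm (trig_sum G w))\<^sup>2 = (norm f)\<^sup>2"
    by (simp add: norm_trig_sum G u)
  then have nw: "norm (trig_sum G w) = norm f"
    by simp
  have "(\<Sum>j\<in>F. cmod (M j j) * (u j)\<^sup>2) \<le> (\<Sum>j\<in>G. cmod (M j j) * (u j)\<^sup>2)"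
    using G by (intro sum_mono2) (auto simp: G_def)
  then have "(1 - q) * (\<Sum>j\<in>F. cmod (M j j) * (u j)\<^sup>2) \<le> (1 - q) * (\<Sum>j\<in>G. cmod (M j j) * (u j)\<^sup>2)"
    using q by (intro mult_left_mono) auto
  also have "\<dots> \<le> (\<Sum>j\<in>G. cmod (M j j) * (u j)\<^sup>2) - (\<Sum>j\<in>G. \<Sum>k\<in>G - {j}. cmod (M j k) * (u j * u k))"
    using off_diagonal_form_bound[OF G(1), of u] by (simp add: algebra_simps)
  also have "\<dots> = (\<Sum>j\<in>G. cmod (M j j) * (u j)\<^sup>2 - (\<Sum>k\<in>G - {j}. cmod (M j k) * (u j * u k)))"
    by (simp add: sum_subtractf)
  also have "\<dots> \<le> (\<Sum>j\<in>G. Re (cnj (w j) * fourier g j))"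
  proof (rule sum_mono)
    fix j assume j: "j \<in> G"
    have "cnj (sgn (M j j)) * M j j = of_real (cmod (M j j))"
      using diag_nonzero[of j]
      by (simp add: sgn_eq mult.commute[of "cnj _"] complex_norm_square[symmetric] power2_eq_square)
    then have "cnj (w j) * (M j j * fourier f j) = of_real (cmod (M j j)) * (fourier f j * cnj (fourier f j))"
      by (simp add: w_def mult_ac)
    also have "\<dots> = of_real (cmod (M j j) * (u j)\<^sup>2)"
      by (simp only: u_def of_real_mult of_real_power complex_norm_square[symmetric])
    finally have 1: "Re (cnj (w j) * (M j j * fourier f j)) = cmod (M j j) * (u j)\<^sup>2"
      by simp
    have "- Re (cnj (w j) * (\<Sum>k\<in>G - {j}. M j k * fourier f k))
        \<le> cmod (cnj (w j) * (\<Sum>k\<in>G - {j}. M j k * fourier f k))"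
      using abs_Re_le_cmod by (metis abs_le_D2)
    also have "\<dots> \<le> (\<Sum>k\<in>G - {j}. cmod (M j k) * (u j * u k))"
      unfolding sum_distrib_left
      by (rule order_trans[OF norm_sum]) (simp add: norm_mult u mult_ac flip: u_def)
    finally show "cmod (M j j) * (u j)\<^sup>2 - (\<Sum>k\<in>G - {j}. cmod (M j k) * (u j * u k))
        \<le> Re (cnj (w j) * fourier g j)"
      using 1 by (simp add: fg[OF j] distrib_left)
  qed
  also have "\<dots> = inner g (trig_sum G w)"
    by (simp add: inner_trig_sum)
  also have "\<dots> \<le> norm g * norm (trig_sum G w)"
    by (rule norm_cauchy_schwarz)
  finally show ?thesis
    by (simp add: nw u_def g_def mult.commute)
qed

text \<open>Only finitely many coefficients enter the left-hand side, so both sides are continuous and the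
  estimate passes to the closure of the graph.\<close>
lemma energy:
  assumes "(f, g) \<in> closure (minimal_graph \<sigma>)" and F: "finite F"
  shows "(1 - q) * (\<Sum>j\<in>F. cmod (M j j) * (cmod (fourier f j))\<^sup>2) \<le> norm f * norm g"
proof -
  let ?A = "{p. (1 - q) * (\<Sum>j\<in>F. cmod (M j j) * (cmod (fourier (fst p) j))\<^sup>2) \<le> norm (fst p) * norm (snd p)}"
  have "closed ?A"
    by (intro closed_Collect_le continuous_intros
        bounded_linear.continuous_on[OF bounded_linear_fourier])
  moreover have "minimal_graph \<sigma> \<subseteq> ?A"
    using energy_trig[OF _ F] by (auto simp: minimal_graph_def)
  ultimately have "closure (minimal_graph \<sigma>) \<subseteq> ?A"
    by (rule closure_minimal[rotated])
  then show ?thesis using assms by auto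
qed

definition inverse_bound :: real where
  "inverse_bound = 1 / ((1 - q) * c)"

lemma inverse_bound_pos: "inverse_bound > 0"
  using q c by (simp add: inverse_bound_def)

lemma a_priori_bound:
  assumes "(f, g) \<in> closure (minimal_graph \<sigma>)"
  shows "norm f \<le> inverse_bound * norm g"
proof -
  have le: "(1 - q) * c * (norm (fourier_partial f N))\<^sup>2 \<le> norm f * norm g" for N
  proof -
    let ?F = "{- int N..int N}"
    have "c * (norm (fourier_partial f N))\<^sup>2 = (\<Sum>j\<in>?F. c * (cmod (fourier f j))\<^sup>2)"
      by (simp add: fourier_partial_def norm_trig_sum sum_distrib_left)
    also have "\<dots> \<le> (\<Sum>j\<in>?F. cmod (M j j) * (cmod (fourier f j))\<^sup>2)"
      by (intro sum_mono mult_right_mono c) simp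
    finally have "(1 - q) * (c * (norm (fourier_partial f N))\<^sup>2) \<le>
        (1 - q) * (\<Sum>j\<in>?F. cmod (M j j) * (cmod (fourier f j))\<^sup>2)"
      using q by (intro mult_left_mono) auto
    also have "\<dots> \<le> norm f * norm g"
      by (rule energy[OF assms]) simp
    finally show ?thesis by (simp add: mult.assoc)
  qed
  have "(\<lambda>N. (1 - q) * c * (norm (fourier_partial f N))\<^sup>2) \<longlonglongrightarrow> (1 - q) * c * (norm f)\<^sup>2"
    by (intro tendsto_intros fourier_partial_tendsto)
  then have "(1 - q) * c * (norm f)\<^sup>2 \<le> norm f * norm g"
    by (rule LIMSEQ_le_const2) (use le in auto)
  then have "norm f * ((1 - q) * c * norm f) \<le> norm f * norm g"
    by (simp add: power2_eq_square mult_ac)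
  then have "f \<noteq> 0 \<Longrightarrow> (1 - q) * c * norm f \<le> norm g"
    by simp
  then show ?thesis
    using q c by (cases "f = 0") (simp_all add: inverse_bound_def pos_le_divide_eq mult.commute)
qed

subsection \<open>Density of the range\<close>

definition trig_range :: "l2_torus set" where
  "trig_range = pseudo_diff \<sigma> ` trig_polys"

lemma pseudo_diff_add:
  assumes "f \<in> trig_polys" "g \<in> trig_polys"
  shows "pseudo_diff \<sigma> (f + g) = pseudo_diff \<sigma> f + pseudo_diff \<sigma> g"
proof (rule fourier_inject)
  fix j
  let ?F = "{k. fourier f k \<noteq> 0} \<union> {k. fourier g k \<noteq> 0}"
  have F: "finite ?F"
    using assms by (simp add: finite_fourier_support)
  have "{k. fourier (f + g) k \<noteq> 0} \<subseteq> ?F" "{k. fourier f k \<noteq> 0} \<subseteq> ?F" "{k. fourier g k \<noteq> 0} \<subseteq> ?F"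
    by (auto simp: fourier_add)
  note this[THEN fourier_pseudo_diff[OF \<sigma> F]]
  then show "fourier (pseudo_diff \<sigma> (f + g)) j = fourier (pseudo_diff \<sigma> f + pseudo_diff \<sigma> g) j"
    by (simp add: fourier_add distrib_left sum.distrib)
qed

lemma pseudo_diff_scaleC:
  assumes "f \<in> trig_polys"
  shows "pseudo_diff \<sigma> (a *\<^sub>C f) = a *\<^sub>C pseudo_diff \<sigma> f"
proof (rule fourier_inject)
  fix j
  let ?F = "{k. fourier f k \<noteq> 0}"
  have F: "finite ?F"
    using assms by (simp add: finite_fourier_support)
  have "{k. fourier (a *\<^sub>C f) k \<noteq> 0} \<subseteq> ?F" "{k. fourier f k \<noteq> 0} \<subseteq> ?F"
    by (auto simp: fourier_scaleC)
  note this[THEN fourier_pseudo_diff[OF \<sigma> F]]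
  then show "fourier (pseudo_diff \<sigma> (a *\<^sub>C f)) j = fourier (a *\<^sub>C pseudo_diff \<sigma> f) j"
    by (simp add: fourier_scaleC sum_distrib_left mult.left_commute)
qed

lemma trig_range_add: "x \<in> trig_range \<Longrightarrow> y \<in> trig_range \<Longrightarrow> x + y \<in> trig_range"
  unfolding trig_range_def using complex_l2.span_add
  by (auto simp: trig_polys_def pseudo_diff_add[unfolded trig_polys_def, symmetric])

lemma trig_range_scaleC: "x \<in> trig_range \<Longrightarrow> a *\<^sub>C x \<in> trig_range"
  unfolding trig_range_def using complex_l2.span_scale
  by (auto simp: trig_polys_def pseudo_diff_scaleC[unfolded trig_polys_def, symmetric])

lemma trig_range_0: "0 \<in> trig_range"
proof -
  have "pseudo_diff \<sigma> (0 *\<^sub>C 0) = 0 *\<^sub>C pseudo_diff \<sigma> 0"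
    by (rule pseudo_diff_scaleC) (simp add: trig_polys_def complex_l2.span_zero)
  then show ?thesis
    unfolding trig_range_def
    by (intro image_eqI[of _ _ 0]) (simp_all add: trig_polys_def complex_l2.span_zero)
qed

text \<open>As the range is a subspace, the distance to it is a seminorm.\<close>
lemma infdist_range_add: "infdist (x + y) trig_range \<le> infdist x trig_range + infdist y trig_range"
proof (rule field_le_epsilon)
  fix e :: real assume "e > 0"
  obtain a where a: "a \<in> trig_range" "dist x a < infdist x trig_range + e / 2"
    using infdist_lessE[of x trig_range "infdist x trig_range + e / 2"] \<open>e > 0\<close> trig_range_0 by auto
  obtain b where b: "b \<in> trig_range" "dist y b < infdist y trig_range + e / 2"
    using infdist_lessE[of y trig_range "infdist y trig_range + e / 2"] \<open>e > 0\<close> trig_range_0 by auto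
  have "infdist (x + y) trig_range \<le> dist (x + y) (a + b)"
    by (intro infdist_le trig_range_add a b)
  also have "\<dots> \<le> dist x a + dist y b"
    by (rule dist_triangle_add)
  finally show "infdist (x + y) trig_range \<le> infdist x trig_range + infdist y trig_range + e"
    using a b by simp
qed

lemma infdist_range_scaleC: "infdist (a *\<^sub>C x) trig_range \<le> cmod a * infdist x trig_range"
proof (rule field_le_epsilon)
  fix e :: real assume "e > 0"
  then have pos: "e / (cmod a + 1) > 0"
    by (simp add: add_nonneg_pos)
  obtain b where b: "b \<in> trig_range" "dist x b < infdist x trig_range + e / (cmod a + 1)"
    using infdist_lessE[of x trig_range "infdist x trig_range + e / (cmod a + 1)"] pos trig_range_0 by auto
  have "infdist (a *\<^sub>C x) trig_range \<le> dist (a *\<^sub>C x) (a *\<^sub>C b)"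
    by (intro infdist_le trig_range_scaleC b)
  also have "\<dots> = cmod a * dist x b"
    by (simp add: dist_norm norm_scaleC complex_l2.scale_right_diff_distrib[symmetric])
  also have "\<dots> \<le> cmod a * (infdist x trig_range + e / (cmod a + 1))"
    using b by (intro mult_left_mono) auto
  also have "\<dots> \<le> cmod a * infdist x trig_range + e"
    unfolding distrib_left using \<open>e > 0\<close> add_nonneg_pos[OF norm_ge_zero[of a] zero_less_one]
    by (simp add: pos_divide_le_eq distrib_left mult.commute)
  finally show "infdist (a *\<^sub>C x) trig_range \<le> cmod a * infdist x trig_range + e" .
qed

lemma infdist_range_trig_sum:
  assumes "finite F"
  shows "infdist (trig_sum F a) trig_range \<le> (\<Sum>k\<in>F. cmod (a k) * infdist (exponential k) trig_range)"
  using assms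
proof induction
  case empty
  then show ?case using trig_range_0 by (simp add: trig_sum_def)
next
  case (insert k F)
  then have "trig_sum (insert k F) a = a k *\<^sub>C exponential k + trig_sum F a"
    by (simp add: trig_sum_def)
  with infdist_range_add[of "a k *\<^sub>C exponential k" "trig_sum F a"]
    infdist_range_scaleC[of "a k" "exponential k"] insert
  show ?case by simp
qed

text \<open>By column dominance, after division by the diagonal entry, column \<open>k\<close> of the matrix represents the
  exponential at \<open>k\<close>, up to an error whose coefficients have absolute sum at most \<open>q\<close>. If \<open>s\<close> is the
  supremum over \<open>k\<close> of the distances of the exponentials from the range, this gives \<open>s \<le> q * s\<close>.\<close>
lemma infdist_range_exponential: "infdist (exponential k) trig_range = 0"
proof -
  let ?d = "\<lambda>k. infdist (exponential k) trig_range"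
  define s where "s = (SUP k. ?d k)"
  have "?d k \<le> 1" for k
    using infdist_le[OF trig_range_0, of "exponential k"] norm_scaleC_exponential[of 1 k] by simp
  then have bdd: "bdd_above (range ?d)"
    by (intro bdd_aboveI2[where M=1])
  have s: "?d k \<le> s" for k
    unfolding s_def by (rule cSUP_upper[OF _ bdd]) simp
  have s0: "0 \<le> s"
    using s[of 0] infdist_nonneg[of "exponential 0" trig_range] by linarith
  have "?d k \<le> q * s" for k
  proof -
    define e where "e = inverse (M k k) *\<^sub>C exponential k"
    define t where "t = pseudo_diff \<sigma> e"
    define r where "r = exponential k - t"
    have e: "e \<in> trig_polys"
      unfolding e_def by (rule scaleC_exponential_in_trig_polys)
    then have t: "t \<in> trig_range"
      by (simp add: t_def trig_range_def)
    have "{j. fourier e j \<noteq> 0} \<subseteq> {k}"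
      by (auto simp: e_def fourier_scaleC fourier_exponential)
    then have "fourier t j = M j k / M k k" for j
      unfolding t_def by (subst fourier_pseudo_diff[OF \<sigma>, of "{k}"])
        (simp_all add: e_def fourier_scaleC fourier_exponential divide_inverse)
    then have r: "fourier r j = (if j = k then 0 else - M j k / M k k)" for j
      using diag_nonzero[of k] by (auto simp: r_def fourier_diff fourier_exponential)
    have "infdist (fourier_partial r N) trig_range \<le> q * s" for N
    proof -
      let ?F = "{- int N..int N}"
      have "infdist (fourier_partial r N) trig_range \<le> (\<Sum>j\<in>?F. cmod (fourier r j) * ?d j)"
        unfolding fourier_partial_def by (rule infdist_range_trig_sum) simp
      also have "\<dots> \<le> (\<Sum>j\<in>?F. cmod (fourier r j) * s)"
        by (intro sum_mono mult_left_mono s) simp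
      also have "\<dots> = (\<Sum>j\<in>?F - {k}. cmod (M j k)) / cmod (M k k) * s"
      proof -
        have "(\<Sum>j\<in>?F. cmod (fourier r j)) = (\<Sum>j\<in>?F - {k}. cmod (M j k) / cmod (M k k))"
          by (rule sum.mono_neutral_cong_right) (auto simp: r norm_divide)
        then show ?thesis
          by (simp add: sum_distrib_right[symmetric] sum_divide_distrib[symmetric])
      qed
      also have "\<dots> \<le> q * s"
        using col[of "?F - {k}" k] diag_pos[of k] s0
        by (intro mult_right_mono) (simp_all add: divide_le_eq)
      finally show ?thesis .
    qed
    moreover have "(\<lambda>N. infdist (fourier_partial r N) trig_range) \<longlonglongrightarrow> infdist r trig_range"
      by (intro tendsto_infdist fourier_partial_tendsto)
    ultimately have "infdist r trig_range \<le> q * s"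
      by (intro LIMSEQ_le_const2) auto
    moreover have "exponential k = r + t"
      by (simp add: r_def)
    ultimately show ?thesis
      using infdist_range_add[of r t] t by simp
  qed
  then have "s \<le> q * s"
    unfolding s_def by (intro cSUP_least) auto
  then have "(1 - q) * s \<le> 0"
    by (simp add: algebra_simps)
  then have "s \<le> 0"
    using q by (simp add: mult_le_0_iff)
  then show ?thesis
    using s[of k] infdist_nonneg[of "exponential k" trig_range] by linarith
qed

lemma trig_range_dense: "closure trig_range = UNIV"
proof -
  have "infdist f trig_range = 0" for f
  proof -
    have "infdist (fourier_partial f N) trig_range = 0" for N
      using infdist_range_trig_sum[of "{- int N..int N}" "fourier f"]
        infdist_nonneg[of "fourier_partial f N" trig_range]
      by (simp add: fourier_partial_def infdist_range_exponential)
    moreover have "(\<lambda>N. infdist (fourier_partial f N) trig_range) \<longlonglongrightarrow> infdist f trig_range"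
      by (intro tendsto_infdist fourier_partial_tendsto)
    ultimately show ?thesis
      by (simp add: LIMSEQ_const_iff)
  qed
  then show ?thesis
    using in_closure_iff_infdist_zero[of trig_range] trig_range_0 by blast
qed

end

section \<open>Relatively compact sets\<close>

lemma compact_trig_sums:
  assumes "finite F"
  shows "compact {trig_sum F a | a. \<forall>k\<in>F. cmod (a k) \<le> \<rho>}"
  using assms
proof induction
  case empty
  then show ?case by (simp add: trig_sum_def)
next
  case (insert k F)
  have "bounded_linear (\<lambda>z. z *\<^sub>C exponential k)"
    by (rule bounded_linear_intro[where K=1])
      (simp_all add: complex_l2.scale_left_distrib scaleR_eq_scaleC scaleR_conv_of_real)
  then have "compact ((\<lambda>z. z *\<^sub>C exponential k) ` cball 0 \<rho>)"
    by (intro compact_continuous_image compact_cball linear_continuous_on)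
  from compact_sums[OF this insert.IH]
  have "compact {x + y |x y. x \<in> (\<lambda>z. z *\<^sub>C exponential k) ` cball 0 \<rho>
      \<and> y \<in> {trig_sum F a | a. \<forall>k\<in>F. cmod (a k) \<le> \<rho>}}" .
  also have "\<dots> = {trig_sum (insert k F) a | a. \<forall>k\<in>insert k F. cmod (a k) \<le> \<rho>}"
  proof safe
    fix z :: complex and a assume z: "z \<in> cball 0 \<rho>" and a: "\<forall>k\<in>F. cmod (a k) \<le> \<rho>"
    have "trig_sum F (a(k := z)) = trig_sum F a"
      unfolding trig_sum_def using insert by (intro sum.cong) auto
    then have "z *\<^sub>C exponential k + trig_sum F a = trig_sum (insert k F) (a(k := z))"
      using insert by (simp add: trig_sum_def)
    then show "\<exists>b. z *\<^sub>C exponential k + trig_sum F a = trig_sum (insert k F) b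
        \<and> (\<forall>k\<in>insert k F. cmod (b k) \<le> \<rho>)"
      using z a by (intro exI[of _ "a(k := z)"]) auto
  next
    fix a assume a: "\<forall>k\<in>insert k F. cmod (a k) \<le> \<rho>"
    then have "trig_sum (insert k F) a = a k *\<^sub>C exponential k + trig_sum F a" "a k \<in> cball 0 \<rho>"
      using insert by (simp_all add: trig_sum_def)
    with a show "\<exists>x y. trig_sum (insert k F) a = x + y \<and> x \<in> (\<lambda>z. z *\<^sub>C exponential k) ` cball 0 \<rho>
        \<and> y \<in> {trig_sum F a | a. \<forall>k\<in>F. cmod (a k) \<le> \<rho>}"
      by blast
  qed
  finally show ?case .
qed

text \<open>A set that is within every positive distance of some compact set is totally bounded.\<close>
lemma compact_closure_if_approximable:
  fixes A :: "'a :: complete_space set"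
  assumes "\<And>e. e > 0 \<Longrightarrow> \<exists>H. compact H \<and> (\<forall>x\<in>A. \<exists>y\<in>H. dist x y < e)"
  shows "compact (closure A)"
  unfolding compact_eq_totally_bounded
proof (intro conjI allI impI)
  show "complete (closure A)"
    by (simp add: complete_eq_closed)
  fix e :: real assume "e > 0"
  then have e3: "e / 3 > 0" by simp
  obtain H where H: "compact H" "\<And>x. x \<in> A \<Longrightarrow> \<exists>y\<in>H. dist x y < e / 3"
    using assms[OF e3] by blast
  obtain K where K: "finite K" "H \<subseteq> (\<Union>x\<in>K. ball x (e / 3))"
    using H(1) e3 unfolding compact_eq_totally_bounded by blast
  have "z \<in> (\<Union>x\<in>K. ball x e)" if "z \<in> closure A" for z
  proof -
    have "\<forall>d>0. \<exists>a\<in>A. dist a z < d"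
      using that by (simp add: closure_approachable)
    from this[rule_format, OF e3] obtain a where a: "a \<in> A" "dist a z < e / 3"
      by blast
    obtain y where y: "y \<in> H" "dist a y < e / 3"
      using H(2)[OF a(1)] by blast
    obtain x where x: "x \<in> K" "dist x y < e / 3"
      using K(2) y(1) by auto
    have "dist x z \<le> dist x y + dist a y + dist a z"
      by (metis add_right_mono dist_commute dist_triangle dist_triangle2 order_trans)
    then have "dist x z < e"
      using a y x by simp
    then show ?thesis
      using x by auto
  qed
  then show "\<exists>K. finite K \<and> closure A \<subseteq> (\<Union>x\<in>K. ball x e)"
    using K(1) by blast
qed

section \<open>The inverse\<close>

lemma abs_mean_eq: "abs_mean \<sigma> k = cmod (symbol_matrix \<sigma> k k)"
  by (simp add: abs_mean_def symbol_matrix_def symbol_hat_def fourier_coeff_def)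

context diagonally_dominant_symbol
begin

lemma pseudo_diff_diff:
  assumes "f \<in> trig_polys" "g \<in> trig_polys"
  shows "pseudo_diff \<sigma> (f - g) = pseudo_diff \<sigma> f - pseudo_diff \<sigma> g"
proof -
  have "- 1 *\<^sub>C h = - h" for h
    using complex_l2.scale_minus_left[of 1 h] by simp
  then show ?thesis
    using pseudo_diff_add[OF assms(1), of "- 1 *\<^sub>C g"] pseudo_diff_scaleC[OF assms(2), of "- 1"] assms(2)
    by (simp add: trig_polys_def complex_l2.span_neg)
qed

text \<open>The range on trigonometric polynomials is dense, and by the a priori bound preimages of a Cauchy
  sequence form a Cauchy sequence.\<close>
lemma minimal_surjective: "\<exists>f. (f, g) \<in> closure (minimal_graph \<sigma>)"
proof -
  have "g \<in> closure trig_range"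
    by (simp add: trig_range_dense)
  then obtain y where y: "\<And>n. y n \<in> trig_range" "y \<longlonglongrightarrow> g"
    unfolding closure_sequential by blast
  then have "\<forall>n. \<exists>f. f \<in> trig_polys \<and> y n = pseudo_diff \<sigma> f"
    by (auto simp: trig_range_def)
  then obtain x where x: "\<And>n. x n \<in> trig_polys" "\<And>n. y n = pseudo_diff \<sigma> (x n)"
    by metis
  have bound: "norm (x m - x n) \<le> inverse_bound * norm (y m - y n)" for m n
  proof (rule a_priori_bound)
    have "x m - x n \<in> trig_polys"
      using x(1) by (simp add: trig_polys_def complex_l2.span_diff)
    then have "(x m - x n, y m - y n) \<in> minimal_graph \<sigma>"
      using x by (auto simp: minimal_graph_def pseudo_diff_diff)
    then show "(x m - x n, y m - y n) \<in> closure (minimal_graph \<sigma>)"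
      using closure_subset by blast
  qed
  have "Cauchy x"
  proof (rule CauchyI)
    fix e :: real assume "e > 0"
    then have "e / inverse_bound > 0"
      using inverse_bound_pos by simp
    then obtain N where N: "\<And>m n. m \<ge> N \<Longrightarrow> n \<ge> N \<Longrightarrow> norm (y m - y n) < e / inverse_bound"
      using CauchyD[OF LIMSEQ_imp_Cauchy[OF y(2)]] by blast
    have "norm (x m - x n) < e" if "m \<ge> N" "n \<ge> N" for m n
      using bound[of m n] N[OF that] inverse_bound_pos by (simp add: pos_less_divide_eq mult.commute)
    then show "\<exists>M. \<forall>m\<ge>M. \<forall>n\<ge>M. norm (x m - x n) < e"
      by blast
  qed
  then obtain f where f: "x \<longlonglongrightarrow> f"
    using Cauchy_convergent convergent_def by blast
  have "(\<lambda>n. (x n, y n)) \<longlonglongrightarrow> (f, g)"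
    by (intro tendsto_Pair f y)
  moreover have "(x n, y n) \<in> minimal_graph \<sigma>" for n
    using x by (auto simp: minimal_graph_def)
  ultimately show ?thesis
    unfolding closure_sequential by (intro exI[of _ f] exI[of _ "\<lambda>n. (x n, y n)"]) auto
qed

text \<open>A surjective operator with an injective extension is equal to it.\<close>
theorem closure_minimal_eq_maximal: "closure (minimal_graph \<sigma>) = maximal_graph \<sigma>"
proof
  show sub: "closure (minimal_graph \<sigma>) \<subseteq> maximal_graph \<sigma>"
    by (rule closure_minimal[OF minimal_subset_maximal closed_maximal_graph])
  show "maximal_graph \<sigma> \<subseteq> closure (minimal_graph \<sigma>)"
  proof (rule subrelI)
    fix f g assume fg: "(f, g) \<in> maximal_graph \<sigma>"
    obtain f' where f': "(f', g) \<in> closure (minimal_graph \<sigma>)"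
      using minimal_surjective by blast
    then have "f' = f"
      using sub fg maximal_graph_left_unique by blast
    then show "(f, g) \<in> closure (minimal_graph \<sigma>)"
      using f' by simp
  qed
qed

definition solution :: "l2_torus \<Rightarrow> l2_torus" where
  "solution g = (THE f. (f, g) \<in> maximal_graph \<sigma>)"

lemma solution_iff: "(f, g) \<in> maximal_graph \<sigma> \<longleftrightarrow> solution g = f"
proof -
  have "\<exists>!f. (f, g) \<in> maximal_graph \<sigma>"
    using minimal_surjective[of g] maximal_graph_left_unique
    unfolding closure_minimal_eq_maximal by blast
  from theI'[OF this] show ?thesis
    using maximal_graph_left_unique unfolding solution_def by blast
qed

lemma solution_in_graph: "(solution g, g) \<in> maximal_graph \<sigma>"
  by (simp add: solution_iff)

lemma solution_add: "solution (f + g) = solution f + solution g"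
  using linear_maximal_graph solution_in_graph
  unfolding linear_operator_def solution_iff[symmetric] by blast

lemma solution_scaleC: "solution (a *\<^sub>C f) = a *\<^sub>C solution f"
  using linear_maximal_graph solution_in_graph
  unfolding linear_operator_def solution_iff[symmetric] by blast

lemma norm_solution: "norm (solution g) \<le> inverse_bound * norm g"
  using a_priori_bound solution_in_graph unfolding closure_minimal_eq_maximal by blast

lemma bounded_solution: "bounded_operator solution"
  unfolding bounded_operator_def
proof (intro conjI allI solution_scaleC)
  show "bounded_linear solution"
    by (rule bounded_linear_intro[where K=inverse_bound])
      (simp_all add: solution_add solution_scaleC scaleR_eq_scaleC norm_solution mult.commute[of _ inverse_bound])
qed

lemma inverse_solution: "inverse_operator (maximal_graph \<sigma>) solution"
  using linear_maximal_graph by (auto simp: inverse_operator_def solution_iff linear_operator_def)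

text \<open>The energy estimate bounds \<open>\<Sum>k. \<bar>M k k\<bar> * \<bar>fourier f k\<bar>\<^sup>2\<close> uniformly for \<open>f\<close> in the image of a bounded
  set. As the weights tend to infinity, the tails of the Fourier series are uniformly small, and
  what remains lies in a compact set of trigonometric polynomials.\<close>
lemma compact_solution:
  assumes lim: "filterlim (abs_mean \<sigma>) at_top (filtercomap (\<lambda>k::int. \<bar>k\<bar>) at_top)"
  shows "compact_operator solution"
  unfolding compact_operator_def
proof (intro conjI allI impI bounded_solution compact_closure_if_approximable)
  fix B :: "l2_torus set" and e :: real
  assume "bounded B" and e: "e > 0"
  then obtain b where b: "b > 0" "\<And>g. g \<in> B \<Longrightarrow> norm g \<le> b"
    by (auto simp: bounded_pos)
  define \<rho> where "\<rho> = inverse_bound * b"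
  define E where "E = \<rho> * b / (1 - q)"
  \<comment> \<open>\<open>E\<close> bounds the energy, and \<open>L\<close> is the weight beyond which this energy leaves a tail of norm at
    most \<open>e / 2\<close>.\<close>
  define L where "L = E / (e / 2)\<^sup>2"
  have E: "E > 0"
    using b inverse_bound_pos q by (simp add: E_def \<rho>_def)
  then have L: "L > 0"
    using e by (simp add: L_def)
  have "\<forall>\<^sub>F k in filtercomap (\<lambda>k::int. \<bar>k\<bar>) at_top. L \<le> abs_mean \<sigma> k"
    using lim by (simp add: filterlim_at_top)
  then obtain K where K: "\<And>k. \<bar>k\<bar> \<ge> K \<Longrightarrow> L \<le> cmod (M k k)"
    by (auto simp: eventually_filtercomap_at_top_linorder abs_mean_eq)
  define N where "N = nat \<bar>K\<bar>"
  define H where "H = {trig_sum {- int N..int N} a | a. \<forall>k\<in>{- int N..int N}. cmod (a k) \<le> \<rho>}"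
  have "\<exists>y\<in>H. dist f y < e" if "f \<in> solution ` B" for f
  proof (intro bexI[of _ "fourier_partial f N"])
    obtain g where g: "g \<in> B" "f = solution g"
      using \<open>f \<in> solution ` B\<close> by blast
    have nf: "norm f \<le> \<rho>"
    proof -
      have "norm f \<le> inverse_bound * norm g"
        by (simp add: g norm_solution)
      also have "\<dots> \<le> \<rho>"
        unfolding \<rho>_def using b g inverse_bound_pos by (intro mult_left_mono) auto
      finally show ?thesis .
    qed
    then have "cmod (fourier f k) \<le> \<rho>" for k
      using cmod_fourier_le order_trans by blast
    then show "fourier_partial f N \<in> H"
      unfolding H_def fourier_partial_def by blast
    have tail: "norm (fourier_partial f n - fourier_partial f N) \<le> e / 2" if "n \<ge> N" for n
    proof -
      let ?F = "{- int n..int n} - {- int N..int N}"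
      have "L * (norm (fourier_partial f n - fourier_partial f N))\<^sup>2
          = (\<Sum>k\<in>?F. L * (cmod (fourier f k))\<^sup>2)"
        by (simp add: norm_fourier_partial_diff[OF that] sum_distrib_left)
      also have "\<dots> \<le> (\<Sum>k\<in>?F. cmod (M k k) * (cmod (fourier f k))\<^sup>2)"
        by (intro sum_mono mult_right_mono K) (auto simp: N_def)
      also have "\<dots> \<le> E"
      proof -
        have "(f, g) \<in> closure (minimal_graph \<sigma>)"
          unfolding closure_minimal_eq_maximal g(2) by (rule solution_in_graph)
        then have "(1 - q) * (\<Sum>k\<in>?F. cmod (M k k) * (cmod (fourier f k))\<^sup>2) \<le> norm f * norm g"
          by (rule energy) simp
        also have "\<dots> \<le> \<rho> * b"
          using nf b g by (intro mult_mono) (auto intro: order_trans[OF norm_ge_zero])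
        finally show ?thesis
          using q by (simp add: E_def pos_le_divide_eq mult.commute)
      qed
      also have "E = L * (e / 2)\<^sup>2"
        using e by (simp add: L_def)
      finally have "(norm (fourier_partial f n - fourier_partial f N))\<^sup>2 \<le> (e / 2)\<^sup>2"
        using L by simp
      then show ?thesis
        by (rule power2_le_imp_le) (use e in simp)
    qed
    have "(\<lambda>n. norm (fourier_partial f n - fourier_partial f N)) \<longlonglongrightarrow> norm (f - fourier_partial f N)"
      by (intro tendsto_intros fourier_partial_tendsto)
    then have "norm (f - fourier_partial f N) \<le> e / 2"
      by (rule LIMSEQ_le_const2) (use tail in auto)
    then show "dist f (fourier_partial f N) < e"
      using e by (simp add: dist_norm)
  qed
  then show "\<exists>H. compact H \<and> (\<forall>x\<in>solution ` B. \<exists>y\<in>H. dist x y < e)"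
    using compact_trig_sums[of "{- int N..int N}" \<rho>] unfolding H_def by blast
qed

text \<open>The Fourier coefficients of \<open>\<sigma>'(\<cdot>, j)\<close> have to be the entries of row \<open>j\<close>, conjugated and shifted by
  \<open>j\<close>. Rows are absolutely summable, so the corresponding Fourier series converge in the Hilbert space.\<close>
lemma adjoint_symbol_exists: "\<exists>\<sigma>'. adjoint_symbol \<sigma> \<sigma>'"
proof -
  define u where "u j = (\<Sum>\<^sub>\<infinity>m. cnj (M j (m + j)) *\<^sub>C exponential m)" for j
  have u: "fourier (u j) m = cnj (M j (m + j))" for j m
  proof -
    have "(\<lambda>k. cmod (M j k)) \<circ> (\<lambda>m. m + j) summable_on UNIV"
      using row_summable[of j] summable_on_reindex[of "\<lambda>m. m + j" UNIV "\<lambda>k. cmod (M j k)"] by simp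
    then have "(\<lambda>m. norm (cnj (M j (m + j)) *\<^sub>C exponential m)) summable_on UNIV"
      by (simp add: o_def)
    then have "(\<lambda>m. cnj (M j (m + j)) *\<^sub>C exponential m) summable_on UNIV"
      by (rule abs_summable_summable)
    from has_sum_bounded_linear[OF bounded_linear_fourier has_sum_infsum[OF this], of m]
    have "fourier (u j) m = (\<Sum>\<^sub>\<infinity>k. fourier (cnj (M j (k + j)) *\<^sub>C exponential k) m)"
      unfolding u_def o_def by (rule infsumI[symmetric])
    also have "\<dots> = (\<Sum>\<^sub>\<infinity>k\<in>{m}. cnj (M j (k + j)))"
      by (rule infsum_cong_neutral) (auto simp: fourier_scaleC fourier_exponential)
    finally show ?thesis by simp
  qed
  have "\<forall>j. \<exists>g. square_integrable g \<and> u j = abs_l2_torus g"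
    using l2_torus_cases by metis
  then obtain v where v: "\<And>j. square_integrable (v j)" "\<And>j. u j = abs_l2_torus (v j)"
    by metis
  note [measurable] = square_integrable_measurable[OF v(1)]
  have "(\<lambda>p. v (snd p) (fst p)) \<in> borel_measurable (haar \<Otimes>\<^sub>M count_space UNIV)"
    by (rule measurable_compose_countable'[where f="\<lambda>k p. v k (fst p)" and g=snd and I=UNIV]) auto
  then have "l2_symbol (\<lambda>x j. v j x)"
    using v(1) by (simp add: l2_symbol_def split_beta')
  moreover have "symbol_matrix (\<lambda>x j. v j x) i j = cnj (M j i)" for i j
    using u[of j "i - j"] v by (simp add: symbol_matrix_def symbol_hat_def fourier.abs_eq)
  ultimately show ?thesis
    unfolding adjoint_symbol_def by blast
qed

end

section \<open>Equivalence of the two forms of diagonal dominance\<close>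

text \<open>The full norm of a column or a row is its off-diagonal sum plus the diagonal entry, which after
  division by the mean contributes exactly one. This accounts for the bounds \<open>1\<close> and \<open>2\<close>.\<close>

lemma infsum_ennreal_split:
  fixes h :: "int \<Rightarrow> ennreal"
  shows "infsum h UNIV = h k + infsum h (- {k})"
  using infsum_Un_disjoint[of h "{k}" "- {k}"] by (simp add: nonneg_summable_on_complete)

lemma l1_norm_column:
  "l1_norm (\<lambda>m. symbol_hat \<sigma> m k)
     = ennreal (abs_mean \<sigma> k) + (\<Sum>\<^sub>\<infinity>j\<in>- {k}. ennreal (cmod (symbol_hat \<sigma> (j - k) k)))"
proof -
  have "bij (\<lambda>j::int. j - k)"
    by (rule bij_betw_byWitness[where f'="\<lambda>m. m + k"]) auto
  from infsum_reindex_bij_betw[OF this, of "\<lambda>m. ennreal (cmod (symbol_hat \<sigma> m k))"]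
  show ?thesis
    unfolding l1_norm_def by (simp add: infsum_ennreal_split[of _ k] abs_mean_eq symbol_matrix_def)
qed

lemma l1_norm_row:
  assumes "adjoint_symbol \<sigma> \<sigma>'"
  shows "l1_norm (\<lambda>m. symbol_hat \<sigma>' m j)
     = ennreal (abs_mean \<sigma> j) + (\<Sum>\<^sub>\<infinity>k\<in>- {j}. ennreal (cmod (symbol_hat \<sigma> (j - k) k)))"
proof -
  have adj: "cmod (symbol_hat \<sigma>' (k - j) j) = cmod (symbol_hat \<sigma> (j - k) k)" for k
    using assms by (simp add: adjoint_symbol_def symbol_matrix_def)
  have "bij (\<lambda>k::int. k - j)"
    by (rule bij_betw_byWitness[where f'="\<lambda>m. m + j"]) auto
  from infsum_reindex_bij_betw[OF this, of "\<lambda>m. ennreal (cmod (symbol_hat \<sigma>' m j))"]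
  show ?thesis
    unfolding l1_norm_def adj[symmetric]
    by (simp add: infsum_ennreal_split[of _ j] abs_mean_eq symbol_matrix_def adj)
qed

lemma SUP_ratio_less_2_iff:
  fixes a :: "int \<Rightarrow> real" and x :: "int \<Rightarrow> ennreal"
  assumes "\<And>k. a k > 0"
  shows "(SUP k. inverse (ennreal (a k)) * (ennreal (a k) + x k)) < 2
    \<longleftrightarrow> (SUP k. inverse (ennreal (a k)) * x k) < 1"
proof -
  have "inverse (ennreal (a k)) * (ennreal (a k) + x k) = inverse (ennreal (a k)) * x k + 1" for k
    using assms[of k] by (simp add: distrib_left inverse_ennreal add.commute flip: ennreal_mult)
  then have "(SUP k. inverse (ennreal (a k)) * (ennreal (a k) + x k))
      = (SUP k. inverse (ennreal (a k)) * x k) + 1"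
    by (simp add: ennreal_SUP_add_left)
  moreover have "s + 1 < 2 \<longleftrightarrow> s < 1" for s :: ennreal
    using ennreal_add_left_cancel_less[of 1 s 1] by (simp add: add.commute)
  ultimately show ?thesis by simp
qed

lemma finite_sum_le_of_ratio:
  fixes a :: real and h :: "int \<Rightarrow> real"
  assumes a: "a > 0" and h: "\<And>j. h j \<ge> 0" and F: "finite F" "F \<subseteq> A" and q: "q \<ge> 0"
    and le: "inverse (ennreal a) * (\<Sum>\<^sub>\<infinity>j\<in>A. ennreal (h j)) \<le> ennreal q"
  shows "sum h F \<le> q * a"
proof -
  have "ennreal (sum h F) = (\<Sum>j\<in>F. ennreal (h j))"
    using h by (simp add: sum_ennreal)
  also have "\<dots> \<le> (\<Sum>\<^sub>\<infinity>j\<in>A. ennreal (h j))"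
    unfolding infsum_finite[OF F(1), symmetric]
    by (intro infsum_mono_neutral nonneg_summable_on_complete) (use F in auto)
  also have "\<dots> = ennreal a * (inverse (ennreal a) * (\<Sum>\<^sub>\<infinity>j\<in>A. ennreal (h j)))"
    using a by (simp add: inverse_ennreal flip: mult.assoc ennreal_mult)
  also have "\<dots> \<le> ennreal a * ennreal q"
    by (intro mult_left_mono le) simp
  also have "\<dots> = ennreal (q * a)"
    using a q by (simp add: mult.commute flip: ennreal_mult)
  finally show ?thesis
    using a q by (subst (asm) ennreal_le_iff) auto
qed

lemma mean_bounded_below_pos:
  assumes "mean_bounded_below \<sigma>" shows "abs_mean \<sigma> k > 0"
  using assms by (simp add: mean_bounded_below_def abs_mean_def)

lemma diagonally_dominant_imp_locale:
  assumes \<sigma>: "l2_symbol \<sigma>" and dd: "diagonally_dominant \<sigma>"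
  shows "\<exists>q c. diagonally_dominant_symbol \<sigma> q c"
proof -
  have mb: "mean_bounded_below \<sigma>"
    using dd by (simp add: diagonally_dominant_def)
  define s where "s = (SUP k. inverse (ennreal (abs_mean \<sigma> k)) *
        (\<Sum>\<^sub>\<infinity>j\<in>- {k}. ennreal (cmod (symbol_hat \<sigma> (j - k) k))))"
  define t where "t = (SUP j. inverse (ennreal (abs_mean \<sigma> j)) *
        (\<Sum>\<^sub>\<infinity>k\<in>- {j}. ennreal (cmod (symbol_hat \<sigma> (j - k) k))))"
  define q where "q = enn2real (max s t)"
  define c where "c = (INF k. abs_mean \<sigma> k)"
  have st: "max s t < 1"
    using dd by (simp add: diagonally_dominant_def s_def t_def)
  then have q: "ennreal q = max s t"
    by (metis ennreal_enn2real ennreal_one_less_top order.strict_trans q_def)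
  have "diagonally_dominant_symbol \<sigma> q c"
  proof
    show "l2_symbol \<sigma>" by fact
    show q0: "0 \<le> q" by (simp add: q_def)
    show "q < 1"
      using st by (simp flip: q)
    show "0 < c"
      using mb by (simp add: mean_bounded_below_def c_def)
    show "c \<le> cmod (symbol_matrix \<sigma> k k)" for k
      unfolding c_def abs_mean_eq[symmetric]
      by (intro cINF_lower bdd_belowI2[where m=0]) (auto simp: abs_mean_def)
    show "(\<Sum>j\<in>F. cmod (symbol_matrix \<sigma> j k)) \<le> q * cmod (symbol_matrix \<sigma> k k)"
      if "finite F" "k \<notin> F" for k F
    proof -
      have "inverse (ennreal (abs_mean \<sigma> k)) *
          (\<Sum>\<^sub>\<infinity>j\<in>- {k}. ennreal (cmod (symbol_hat \<sigma> (j - k) k))) \<le> s"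
        unfolding s_def by (rule SUP_upper) simp
      then show ?thesis
        using that mean_bounded_below_pos[OF mb, of k] q0
        by (intro finite_sum_le_of_ratio[where A="- {k}", THEN order_trans])
          (auto simp: q le_max_iff_disj abs_mean_eq symbol_matrix_def)
    qed
    show "(\<Sum>k\<in>F. cmod (symbol_matrix \<sigma> j k)) \<le> q * cmod (symbol_matrix \<sigma> j j)"
      if "finite F" "j \<notin> F" for j F
    proof -
      have "inverse (ennreal (abs_mean \<sigma> j)) *
          (\<Sum>\<^sub>\<infinity>k\<in>- {j}. ennreal (cmod (symbol_hat \<sigma> (j - k) k))) \<le> t"
        unfolding t_def by (rule SUP_upper) simp
      then show ?thesis
        using that mean_bounded_below_pos[OF mb, of j] q0
        by (intro finite_sum_le_of_ratio[where A="- {j}", THEN order_trans])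
          (auto simp: q le_max_iff_disj abs_mean_eq symbol_matrix_def)
    qed
  qed
  then show ?thesis by blast
qed

text \<open>The second form speaks about the adjoint symbol. For the forward implication its existence has to
  be derived from the first form.\<close>
lemma diagonally_dominant_iff_l1:
  assumes \<sigma>: "l2_symbol \<sigma>"
  shows "diagonally_dominant \<sigma> \<longleftrightarrow> diagonally_dominant_l1 \<sigma>"
proof (cases "mean_bounded_below \<sigma>")
  case False
  then show ?thesis
    by (simp add: diagonally_dominant_def diagonally_dominant_l1_def)
next
  case True
  note ratio = SUP_ratio_less_2_iff[OF mean_bounded_below_pos[OF True]]
  have "\<exists>\<sigma>'. adjoint_symbol \<sigma> \<sigma>'" if "diagonally_dominant \<sigma>"
    using diagonally_dominant_imp_locale[OF \<sigma> that] diagonally_dominant_symbol.adjoint_symbol_exists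
    by blast
  moreover have "(SUP j. inverse (ennreal (abs_mean \<sigma> j)) * l1_norm (\<lambda>m. symbol_hat \<sigma>' m j)) < 2
      \<longleftrightarrow> (SUP j. inverse (ennreal (abs_mean \<sigma> j)) *
        (\<Sum>\<^sub>\<infinity>k\<in>- {j}. ennreal (cmod (symbol_hat \<sigma> (j - k) k)))) < 1"
    if "adjoint_symbol \<sigma> \<sigma>'" for \<sigma>'
    unfolding l1_norm_row[OF that] by (rule ratio)
  ultimately show ?thesis
    using True unfolding diagonally_dominant_l1_def diagonally_dominant_def l1_norm_column ratio
    by blast
qed

theorem theorem3p4:
  fixes \<sigma> :: "torus \<Rightarrow> int \<Rightarrow> complex"
  assumes "l2_symbol \<sigma>"
  shows "(diagonally_dominant \<sigma> \<longleftrightarrow> diagonally_dominant_l1 \<sigma>) \<and>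
    (diagonally_dominant \<sigma> \<or> diagonally_dominant_l1 \<sigma> \<longrightarrow>
      linear_operator (closure (minimal_graph \<sigma>)) \<and>
      linear_operator (maximal_graph \<sigma>) \<and>
      (\<exists>S. bounded_operator S \<and>
        inverse_operator (closure (minimal_graph \<sigma>)) S \<and>
        inverse_operator (maximal_graph \<sigma>) S \<and>
        (filterlim (abs_mean \<sigma>) at_top (filtercomap (\<lambda>k::int. \<bar>k\<bar>) at_top) \<longrightarrow>
          compact_operator S)))"
proof (intro conjI impI)
  show equiv: "diagonally_dominant \<sigma> \<longleftrightarrow> diagonally_dominant_l1 \<sigma>"
    by (rule diagonally_dominant_iff_l1[OF assms])
  assume "diagonally_dominant \<sigma> \<or> diagonally_dominant_l1 \<sigma>"
  then obtain q c where "diagonally_dominant_symbol \<sigma> q c"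
    using equiv diagonally_dominant_imp_locale[OF assms] by blast
  then interpret diagonally_dominant_symbol \<sigma> q c .
  show "linear_operator (closure (minimal_graph \<sigma>))" "linear_operator (maximal_graph \<sigma>)"
    by (simp_all add: closure_minimal_eq_maximal linear_maximal_graph)
  show "\<exists>S. bounded_operator S \<and>
        inverse_operator (closure (minimal_graph \<sigma>)) S \<and>
        inverse_operator (maximal_graph \<sigma>) S \<and>
        (filterlim (abs_mean \<sigma>) at_top (filtercomap (\<lambda>k::int. \<bar>k\<bar>) at_top) \<longrightarrow>
          compact_operator S)"
    by (intro exI[of _ solution])
      (simp add: closure_minimal_eq_maximal bounded_solution inverse_solution compact_solution)
qed

end
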